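(* Let $E$ be a metric space, let $T=\{T_t\}_{t\in\mathbb{R}^+}$ be a family of linear operators on $UC_b(E)$, and let $\alpha\in\mathbb{R}$. Then $T$ is a $\pi$-semigroup in $UC_b(E)$ satisfying, with this $\alpha$ and some $M\ge1$, the bound $|T_tf|_\infty\le Me^{\alpha t}|f|_\infty$ for all $t\in\mathbb{R}^+$ and $f\in UC_b(E)$, if and only if $\{e^{-\alpha t}T_t\}_{t\in\mathbb{R}^+}$ is a bounded $C_0$-sequentially continuous semigroup in $(UC_b(E),\sigma(UC_b(E),\mathbf{ca}(E)))$.
   Context: $\mathbb{R}^+=[0,+\infty)$; $UC_b(E)$ is the space of bounded uniformly continuous real-valued functions on $E$ with sup-norm $|\cdot|_\infty$. $\mathbf{ca}(E)$ is the space of countably additive finite signed Borel measures on $E$; $\sigma(UC_b(E),\mathbf{ca}(E))$ is the weakest locally convex topology on $UC_b(E)$ making continuous all functionals $f\mapsto\int_Ef\,d\mu$, $\mu\in\mathbf{ca}(E)$. A $\pi$-semigroup on $UC_b(E)$ is a family $T=\{T_t\}_{t\in\mathbb{R}^+}$ of bounded linear operators on $(UC_b(E),|\cdot|_\infty)$ such that: (P1) $T_0=I$ and $T_tT_s=T_{t+s}$ for $t,s\in\mathbb{R}^+$; (P2) there exist $M\ge1$, $\alpha\in\mathbb{R}$ such that $|T_tf|_\infty\le Me^{\alpha t}|f|_\infty$ for all $t\in\mathbb{R}^+$, $f\in UC_b(E)$; (P3) for each $\xi\in E$ and $f\in UC_b(E)$, the map $\mathbb{R}^+\to\mathbb{R}$,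 $t\mapsto T_tf(\xi)$, is continuous; (P4) if a sequence $\{f_n\}_{n\in\mathbb{N}}\subset UC_b(E)$ satisfies $\sup_n|f_n|_\infty<+\infty$ and $f_n\to f$ pointwise with $f\in UC_b(E)$, then $T_tf_n\to T_tf$ pointwise for every $t\in\mathbb{R}^+$. For a Hausdorff locally convex space $X$, a family $T=\{T_t\}_{t\in\mathbb{R}^+}$ of sequentially continuous linear operators $X\to X$ is a bounded $C_0$-sequentially continuous semigroup if $T_0=I$ and $T_{t+s}=T_tT_s$ for all $t,s\in\mathbb{R}^+$, and for each $x\in X$ the map $\mathbb{R}^+\to X$, $t\mapsto T_tx$, is continuous and bounded. *)

theory Defs
  imports "HOL-Analysis.Analysis"
begin

section \<open>Bounded uniformly continuous functions\<close>

typedef (overloaded) ('a::metric_space) ucb =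
  "{f :: 'a \<Rightarrow> real. uniformly_continuous_on UNIV f \<and> bounded (range f)}"
  morphisms apply_ucb Ucb
  by (auto intro!: exI[of _ "\<lambda>_. 0"] uniformly_continuous_on_const simp: image_def)

declare [[coercion "apply_ucb :: 'a::metric_space ucb \<Rightarrow> 'a \<Rightarrow> real"]]

setup_lifting type_definition_ucb

lemma ucb_eqI: "(\<And>x. apply_ucb f x = apply_ucb g x) \<Longrightarrow> f = g"
  by transfer auto

lemma ucb_uniformly_continuous: "uniformly_continuous_on UNIV (apply_ucb f)"
  and ucb_bounded: "bounded (range (apply_ucb f))"
  using apply_ucb[of f] by auto

lemma ucb_continuous: "continuous_on UNIV (apply_ucb f)"
  by (rule uniformly_continuous_imp_continuous[OF ucb_uniformly_continuous])

instantiation ucb :: (metric_space) real_vector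
begin

lift_definition uminus_ucb :: "'a ucb \<Rightarrow> 'a ucb" is "\<lambda>f x. - f x"
  by (auto intro: uniformly_continuous_on_minus)

lift_definition plus_ucb :: "'a ucb \<Rightarrow> 'a ucb \<Rightarrow> 'a ucb" is "\<lambda>f g x. f x + g x"
  by (auto intro: uniformly_continuous_on_add bounded_plus_comp)

lift_definition minus_ucb :: "'a ucb \<Rightarrow> 'a ucb \<Rightarrow> 'a ucb" is "\<lambda>f g x. f x - g x"
  by (auto intro: uniformly_continuous_on_diff bounded_minus_comp)

lift_definition zero_ucb :: "'a ucb" is "\<lambda>_. 0"
  by (auto intro: uniformly_continuous_on_const simp: image_def)

lift_definition scaleR_ucb :: "real \<Rightarrow> 'a ucb \<Rightarrow> 'a ucb" is "\<lambda>r f x. r * f x"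
  using bounded_scaleR_comp[where 'a = 'a and 'b = real] uniformly_continuous_on_cmul[where 'b = real]
  by fastforce

lemmas ucb_rep_eqs [simp] =
  uminus_ucb.rep_eq plus_ucb.rep_eq minus_ucb.rep_eq zero_ucb.rep_eq scaleR_ucb.rep_eq

instance
  by standard (auto intro!: ucb_eqI simp: algebra_simps)

end

instantiation ucb :: (metric_space) real_normed_vector
begin

definition norm_ucb :: "'a ucb \<Rightarrow> real"
  where "norm_ucb f = (SUP x. \<bar>apply_ucb f x\<bar>)"

definition dist_ucb :: "'a ucb \<Rightarrow> 'a ucb \<Rightarrow> real"
  where "dist_ucb f g = norm (f - g)"

definition sgn_ucb :: "'a ucb \<Rightarrow> 'a ucb"
  where "sgn_ucb f = f /\<^sub>R norm f"

definition uniformity_ucb :: "('a ucb \<times> 'a ucb) filter"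
  where "uniformity_ucb = (INF e\<in>{0 <..}. principal {(x, y). dist x y < e})"

definition open_ucb :: "'a ucb set \<Rightarrow> bool"
  where "open_ucb S = (\<forall>x\<in>S. \<forall>\<^sub>F (x', y) in uniformity. x' = x \<longrightarrow> y \<in> S)"

lemma abs_apply_ucb_le_norm: "\<bar>apply_ucb f x\<bar> \<le> norm f"
proof -
  have "bdd_above (range (\<lambda>x. \<bar>apply_ucb f x\<bar>))"
    using ucb_bounded[of f] by (auto simp: bounded_iff bdd_above_def)
  then show ?thesis
    unfolding norm_ucb_def by (intro cSUP_upper) auto
qed

lemma norm_ucb_le: "(\<And>x. \<bar>apply_ucb f x\<bar> \<le> b) \<Longrightarrow> norm f \<le> b"
  unfolding norm_ucb_def by (intro cSUP_least) auto

instance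
proof
  fix f g :: "'a ucb" and a :: real
  have nonneg: "0 \<le> norm h" for h :: "'a ucb"
    using abs_apply_ucb_le_norm[of h undefined] by linarith
  show "(norm f = 0) = (f = 0)"
  proof
    assume "norm f = 0"
    then have "apply_ucb f x = 0" for x
      using abs_apply_ucb_le_norm[of f x] by simp
    then show "f = 0" by (intro ucb_eqI) simp
  next
    assume "f = 0"
    then have "norm f \<le> 0" by (intro norm_ucb_le) simp
    then show "norm f = 0" using nonneg[of f] by linarith
  qed
  show "norm (f + g) \<le> norm f + norm g"
  proof (rule norm_ucb_le)
    fix x show "\<bar>apply_ucb (f + g) x\<bar> \<le> norm f + norm g"
      using abs_apply_ucb_le_norm[of f x] abs_apply_ucb_le_norm[of g x] by simp
  qed
  have le: "norm (c *\<^sub>R h) \<le> \<bar>c\<bar> * norm h" for c :: real and h :: "'a ucb"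
    by (rule norm_ucb_le) (simp add: abs_mult mult_left_mono abs_apply_ucb_le_norm)
  show "norm (a *\<^sub>R f) = \<bar>a\<bar> * norm f"
  proof (cases "a = 0")
    case True
    then show ?thesis using le[of a f] nonneg[of "a *\<^sub>R f"] by simp
  next
    case False
    have "norm f = norm (inverse a *\<^sub>R (a *\<^sub>R f))" using False by simp
    also have "\<dots> \<le> \<bar>inverse a\<bar> * norm (a *\<^sub>R f)" by (rule le)
    finally have "\<bar>a\<bar> * norm f \<le> norm (a *\<^sub>R f)"
      using False by (simp add: field_simps abs_inverse)
    then show ?thesis using le[of a f] by linarith
  qed
qed (rule dist_ucb_def sgn_ucb_def uniformity_ucb_def open_ucb_def)+

end


section \<open>Finite signed Borel measures\<close>

text \<open>A signed measure is a set function constrained on Borel sets only; its values elsewhere are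
  never used.\<close>

definition ca :: "('a::topological_space set \<Rightarrow> real) set" where
  "ca = {\<mu>. \<mu> {} = 0 \<and>
     (\<forall>A :: nat \<Rightarrow> 'a set. range A \<subseteq> sets borel \<longrightarrow> disjoint_family A \<longrightarrow>
        (\<lambda>n. \<mu> (A n)) sums \<mu> (\<Union>n. A n))}"

text \<open>The positive part of the Jordan decomposition is the upper variation
  \<open>A \<mapsto> sup {\<mu> B | B \<subseteq> A}\<close>. The truncation of \<open>\<mu> B\<close> at \<open>0\<close> by \<open>ennreal\<close> does not affect the
  supremum, since \<open>B = {}\<close> is admitted.\<close>

definition pos_variation :: "('a::topological_space set \<Rightarrow> real) \<Rightarrow> 'a measure" where
  "pos_variation \<mu> =
     measure_of UNIV (sets borel) (\<lambda>A. SUP B\<in>{B \<in> sets borel. B \<subseteq> A}. ennreal (\<mu> B))"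

definition neg_variation :: "('a::topological_space set \<Rightarrow> real) \<Rightarrow> 'a measure" where
  "neg_variation \<mu> = pos_variation (\<lambda>A. - \<mu> A)"

definition signed_integral :: "('a::topological_space set \<Rightarrow> real) \<Rightarrow> ('a \<Rightarrow> real) \<Rightarrow> real" where
  "signed_integral \<mu> f =
     integral\<^sup>L (pos_variation \<mu>) f - integral\<^sup>L (neg_variation \<mu>) f"

lemma sets_pos_variation [simp]: "sets (pos_variation \<mu>) = sets borel"
  and space_pos_variation [simp]: "space (pos_variation \<mu>) = UNIV"
  using sets.space_closed[of borel] sets.sigma_sets_eq[of borel]
  by (simp_all add: pos_variation_def sets_measure_of_conv space_measure_of_conv)

lemma sets_neg_variation [simp]: "sets (neg_variation \<mu>) = sets borel"
  and space_neg_variation [simp]: "space (neg_variation \<mu>) = UNIV"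
  by (simp_all add: neg_variation_def)

lemma ca_uminus: "\<mu> \<in> ca \<Longrightarrow> (\<lambda>A. - \<mu> A) \<in> ca"
  by (auto simp: ca_def intro: sums_minus)

lemma ca_Un:
  assumes "\<mu> \<in> ca" "A \<in> sets borel" "B \<in> sets borel" "A \<inter> B = {}"
  shows "\<mu> (A \<union> B) = \<mu> A + \<mu> B"
proof -
  define C where "C = (\<lambda>n::nat. if n = 0 then A else if n = 1 then B else {})"
  have "range C \<subseteq> sets borel" "disjoint_family C"
    using assms by (auto simp: C_def disjoint_family_on_def)
  then have "(\<lambda>n. \<mu> (C n)) sums \<mu> (\<Union>n. C n)"
    using assms(1) by (auto simp: ca_def)
  moreover have "(\<Union>n. C n) = A \<union> B"
    by (force simp: C_def split: if_splits)
  moreover have "(\<lambda>n. \<mu> (C n)) sums (\<Sum>n\<in>{0,1}. \<mu> (C n))"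
    using assms(1) by (intro sums_finite) (auto simp: C_def ca_def)
  ultimately show ?thesis
    by (auto simp: C_def dest: sums_unique2)
qed

lemma ca_Diff:
  assumes "\<mu> \<in> ca" "A \<in> sets borel" "B \<in> sets borel" "B \<subseteq> A"
  shows "\<mu> (A - B) = \<mu> A - \<mu> B"
proof -
  have "\<mu> (B \<union> (A - B)) = \<mu> B + \<mu> (A - B)"
    using assms by (intro ca_Un) auto
  moreover have "B \<union> (A - B) = A" using assms(4) by blast
  ultimately show ?thesis by simp
qed

lemma ca_bounded:
  fixes \<mu> :: "'a::topological_space set \<Rightarrow> real"
  assumes mu: "\<mu> \<in> ca"
  shows "\<exists>K. \<forall>B \<in> sets borel. \<bar>\<mu> B\<bar> \<le> K"
proof (rule ccontr)
  define unb where "unb A \<longleftrightarrow> A \<in> sets borel \<and> (\<forall>K. \<exists>B \<in> sets borel. B \<subseteq> A \<and> \<bar>\<mu> B\<bar> > K)"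
    for A :: "'a set"
  assume "\<not> ?thesis"
  then have unb_UNIV: "unb UNIV" by (auto simp: unb_def not_le)
  have step: "\<exists>A'. unb A' \<and> A' \<subseteq> A \<and> \<bar>\<mu> (A - A')\<bar> \<ge> 1" if A: "unb A" for A
  proof -
    from A obtain B where B: "B \<in> sets borel" "B \<subseteq> A" "\<bar>\<mu> B\<bar> > 1 + \<bar>\<mu> A\<bar>"
      unfolding unb_def by blast
    have As: "A \<in> sets borel" using A by (simp add: unb_def)
    have D: "\<mu> (A - B) = \<mu> A - \<mu> B" by (rule ca_Diff[OF mu As B(1,2)])
    have "unb B \<or> unb (A - B)"
    proof (rule ccontr)
      assume "\<not> ?thesis"
      then have nu: "\<not> unb B" "\<not> unb (A - B)" by blast+
      from nu(1) B(1) obtain K1 where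
        K1: "\<And>C. C \<in> sets borel \<Longrightarrow> C \<subseteq> B \<Longrightarrow> \<bar>\<mu> C\<bar> \<le> K1"
        unfolding unb_def by (meson not_less)
      from B(1) As have "A - B \<in> sets borel" by blast
      with nu(2) obtain K2 where
        K2: "\<And>C. C \<in> sets borel \<Longrightarrow> C \<subseteq> A - B \<Longrightarrow> \<bar>\<mu> C\<bar> \<le> K2"
        unfolding unb_def by (meson not_less)
      from A obtain C where C: "C \<in> sets borel" "C \<subseteq> A" "\<bar>\<mu> C\<bar> > K1 + K2"
        unfolding unb_def by blast
      have "\<mu> ((C \<inter> B) \<union> (C - B)) = \<mu> (C \<inter> B) + \<mu> (C - B)"
        using B C by (intro ca_Un[OF mu]) auto
      moreover have "(C \<inter> B) \<union> (C - B) = C" by blast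
      moreover have "\<bar>\<mu> (C \<inter> B)\<bar> \<le> K1" using B C by (intro K1) auto
      moreover have "\<bar>\<mu> (C - B)\<bar> \<le> K2" using B C by (intro K2) auto
      ultimately show False using C(3) by simp
    qed
    then show ?thesis
    proof
      assume "unb B"
      then show ?thesis using B D by (intro exI[of _ B]) auto
    next
      assume "unb (A - B)"
      moreover have "A - (A - B) = B" using B(2) by blast
      ultimately show ?thesis using B by (intro exI[of _ "A - B"]) auto
    qed
  qed
  have "\<exists>A. \<forall>n::nat. unb (A n) \<and> (A (Suc n) \<subseteq> A n \<and> \<bar>\<mu> (A n - A (Suc n))\<bar> \<ge> 1)"
  proof (rule dependent_nat_choice)
    show "\<exists>A. unb A" using unb_UNIV by (rule exI)
    show "\<exists>A'. unb A' \<and> (A' \<subseteq> A \<and> \<bar>\<mu> (A - A')\<bar> \<ge> 1)" if "unb A" for A and n :: nat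
      using that by (rule step)
  qed
  then obtain A where A: "\<And>n::nat. unb (A n)"
    "\<And>n. A (Suc n) \<subseteq> A n \<and> \<bar>\<mu> (A n - A (Suc n))\<bar> \<ge> 1" by metis
  have anti: "A n \<subseteq> A m" if "m \<le> n" for m n
    using lift_Suc_antimono_le[of A, OF conjunct1[OF A(2)] that] .
  have "disjoint_family (\<lambda>n. A n - A (Suc n))"
    unfolding disjoint_family_on_def
  proof (intro ballI impI)
    fix m n :: nat assume "m \<noteq> n"
    then consider "Suc m \<le> n" | "Suc n \<le> m" by linarith
    then show "(A m - A (Suc m)) \<inter> (A n - A (Suc n)) = {}"
      using anti by cases blast+
  qed
  moreover have "range (\<lambda>n. A n - A (Suc n)) \<subseteq> sets borel"
    using A(1) by (auto simp: unb_def)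
  ultimately have "summable (\<lambda>n. \<mu> (A n - A (Suc n)))"
    using mu by (auto simp: ca_def intro: sums_summable)
  then have "(\<lambda>n. \<mu> (A n - A (Suc n))) \<longlonglongrightarrow> 0"
    by (rule summable_LIMSEQ_zero)
  then obtain n where "\<bar>\<mu> (A n - A (Suc n))\<bar> < 1"
    by (auto simp: lim_sequentially dest!: spec[of _ "1::real"])
  then show False using A(2)[of n] by simp
qed

lemma emeasure_pos_variation:
  fixes \<mu> :: "'a::topological_space set \<Rightarrow> real"
  assumes mu: "\<mu> \<in> ca" and A: "A \<in> sets borel"
  shows "emeasure (pos_variation \<mu>) A = (SUP B\<in>{B \<in> sets borel. B \<subseteq> A}. ennreal (\<mu> B))"
proof -
  define p where "p A = (SUP B\<in>{B \<in> sets borel. B \<subseteq> A}. ennreal (\<mu> B))" for A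
  have up: "ennreal (\<mu> B) \<le> p A" if "B \<in> sets borel" "B \<subseteq> A" for A B
    unfolding p_def using that by (intro SUP_upper) auto
  have mono: "p A \<le> p B" if "A \<subseteq> B" for A B
    unfolding p_def using that by (intro SUP_subset_mono) auto
  have mu0: "\<mu> {} = 0" using mu by (simp add: ca_def)
  have p0: "p {} = 0"
    unfolding p_def by (auto simp: mu0 simp flip: bot_ennreal)
  have super: "p A + p B \<le> p (A \<union> B)"
    if "A \<in> sets borel" "B \<in> sets borel" "A \<inter> B = {}" for A B
  proof -
    have le: "ennreal (\<mu> C) + ennreal (\<mu> D) \<le> p (A \<union> B)"
      if CD: "C \<in> sets borel" "C \<subseteq> A" "D \<in> sets borel" "D \<subseteq> B" for C D
    proof (cases "\<mu> C \<ge> 0 \<and> \<mu> D \<ge> 0")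
      case True
      have "\<mu> (C \<union> D) = \<mu> C + \<mu> D"
        using CD \<open>A \<inter> B = {}\<close> by (intro ca_Un[OF mu]) auto
      then have "ennreal (\<mu> C) + ennreal (\<mu> D) = ennreal (\<mu> (C \<union> D))"
        using True by simp
      also have "\<dots> \<le> p (A \<union> B)" using CD by (intro up) auto
      finally show ?thesis .
    next
      case False
      then consider "\<mu> C \<le> 0" | "\<mu> D \<le> 0" by linarith
      then show ?thesis
      proof cases
        case 1
        then show ?thesis using up[of D "A \<union> B"] CD by (auto simp: ennreal_neg)
      next
        case 2
        then show ?thesis using up[of C "A \<union> B"] CD by (auto simp: ennreal_neg)
      qed
    qed
    have ne: "{C \<in> sets borel. C \<subseteq> A} \<noteq> {}" for A :: "'a set" by blast
    have "ennreal (\<mu> C) + p B \<le> p (A \<union> B)" if "C \<in> sets borel" "C \<subseteq> A" for C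
      unfolding p_def[of B] ennreal_SUP_add_right[OF ne]
      using that by (intro SUP_least) (auto intro: le)
    then show ?thesis
      unfolding p_def[of A] ennreal_SUP_add_left[OF ne, symmetric]
      by (intro SUP_least) auto
  qed
  have ca_p: "countably_additive (sets borel) p"
    unfolding countably_additive_def
  proof (intro allI impI)
    fix A :: "nat \<Rightarrow> 'a set"
    assume A: "range A \<subseteq> sets borel" "disjoint_family A" "(\<Union>n. A n) \<in> sets borel"
    show "(\<Sum>n. p (A n)) = p (\<Union>n. A n)"
    proof (rule antisym)
      have "(\<Sum>n<N. p (A n)) \<le> p (\<Union>n<N. A n)" for N
      proof (induction N)
        case (Suc N)
        have "(\<Sum>n<Suc N. p (A n)) \<le> p (\<Union>n<N. A n) + p (A N)"
          using Suc.IH by (simp add: add_right_mono)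
        also have "\<dots> \<le> p ((\<Union>n<N. A n) \<union> A N)"
        proof (rule super)
          show "(\<Union>n<N. A n) \<inter> A N = {}"
          proof -
            have "A n \<inter> A N = {}" if "n < N" for n
              using disjoint_family_onD[OF A(2), of n N] that by simp
            then show ?thesis by blast
          qed
        qed (use A(1) in auto)
        also have "(\<Union>n<N. A n) \<union> A N = (\<Union>n<Suc N. A n)"
          by (auto simp: lessThan_Suc)
        finally show ?case .
      qed (simp add: p0)
      also have "p (\<Union>n<N. A n) \<le> p (\<Union>n. A n)" for N
        by (intro mono) auto
      finally show "(\<Sum>n. p (A n)) \<le> p (\<Union>n. A n)"
        by (intro suminf_le_const summableI)
    next
      show "p (\<Union>n. A n) \<le> (\<Sum>n. p (A n))"
        unfolding p_def[of "\<Union>n. A n"]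
      proof (rule SUP_least, clarify)
        fix B :: "'a set" assume B: "B \<in> sets borel" "B \<subseteq> (\<Union>n. A n)"
        have "disjoint_family (\<lambda>n. B \<inter> A n)"
          using A(2) by (auto simp: disjoint_family_on_def)
        moreover have "range (\<lambda>n. B \<inter> A n) \<subseteq> sets borel"
          using A(1) B(1) by auto
        ultimately have "(\<lambda>n. \<mu> (B \<inter> A n)) sums \<mu> (\<Union>n. B \<inter> A n)"
          using mu unfolding ca_def by blast
        moreover have "(\<Union>n. B \<inter> A n) = B" using B(2) by blast
        ultimately have s: "(\<lambda>N. \<Sum>n<N. \<mu> (B \<inter> A n)) \<longlonglongrightarrow> \<mu> B"
          by (simp add: sums_def)
        have "ennreal (\<Sum>n<N. \<mu> (B \<inter> A n)) \<le> (\<Sum>n. p (A n))" for N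
        proof -
          have "ennreal (\<Sum>n<N. \<mu> (B \<inter> A n)) \<le> ennreal (\<Sum>n<N. max 0 (\<mu> (B \<inter> A n)))"
            by (intro ennreal_leI sum_mono) simp
          also have "\<dots> = (\<Sum>n<N. ennreal (max 0 (\<mu> (B \<inter> A n))))"
            by (simp add: sum_ennreal)
          also have "\<dots> \<le> (\<Sum>n<N. p (A n))"
            using A(1) B(1) by (intro sum_mono) (auto simp: max_def ennreal_neg intro!: up)
          also have "\<dots> \<le> (\<Sum>n. p (A n))"
            by (intro sum_le_suminf summableI) auto
          finally show ?thesis .
        qed
        moreover have "(\<lambda>N. ennreal (\<Sum>n<N. \<mu> (B \<inter> A n))) \<longlonglongrightarrow> ennreal (\<mu> B)"
          by (rule tendsto_ennrealI[OF s])
        ultimately show "ennreal (\<mu> B) \<le> (\<Sum>n. p (A n))"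
          by (intro LIMSEQ_le_const2) auto
      qed
    qed
  qed
  have sa: "sigma_algebra UNIV (sets (borel :: 'a measure))"
    using sets.sigma_algebra_axioms[of "borel :: 'a measure"] by simp
  have "emeasure (pos_variation \<mu>) A = p A"
    unfolding pos_variation_def p_def[symmetric]
    using sa A ca_p by (intro emeasure_measure_of_sigma) (auto simp: positive_def p0)
  then show ?thesis by (simp add: p_def)
qed

lemma finite_measure_pos_variation:
  assumes mu: "\<mu> \<in> ca"
  shows "finite_measure (pos_variation \<mu>)"
proof
  obtain K where K: "\<And>B. B \<in> sets borel \<Longrightarrow> \<bar>\<mu> B\<bar> \<le> K"
    using ca_bounded[OF mu] by blast
  have "emeasure (pos_variation \<mu>) UNIV \<le> ennreal K"
    unfolding emeasure_pos_variation[OF mu borel_open[OF open_UNIV]]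
    using K by (intro SUP_least ennreal_leI) (auto simp: abs_le_iff)
  then show "emeasure (pos_variation \<mu>) (space (pos_variation \<mu>)) \<noteq> \<infinity>"
    by (auto simp: top_unique)
qed

lemma finite_measure_neg_variation: "\<mu> \<in> ca \<Longrightarrow> finite_measure (neg_variation \<mu>)"
  unfolding neg_variation_def by (intro finite_measure_pos_variation ca_uminus)

lemma jordan_decomposition:
  assumes mu: "\<mu> \<in> ca" and A: "A \<in> sets borel"
  shows "\<mu> A = measure (pos_variation \<mu>) A - measure (neg_variation \<mu>) A"
proof -
  interpret p: finite_measure "pos_variation \<mu>" by (rule finite_measure_pos_variation[OF mu])
  interpret n: finite_measure "neg_variation \<mu>" by (rule finite_measure_neg_variation[OF mu])
  have p_up: "\<mu> B \<le> measure (pos_variation \<mu>) A" if "\<mu> \<in> ca" "B \<in> sets borel" "B \<subseteq> A" for \<mu> B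
  proof -
    interpret finite_measure "pos_variation \<mu>" by (rule finite_measure_pos_variation[OF that(1)])
    have "ennreal (\<mu> B) \<le> emeasure (pos_variation \<mu>) A"
      unfolding emeasure_pos_variation[OF that(1) A] using that by (intro SUP_upper) auto
    then show ?thesis by (simp add: emeasure_eq_measure)
  qed
  have p_least: "measure (pos_variation \<mu>) A \<le> c"
    if "\<mu> \<in> ca" and c: "\<And>B. B \<in> sets borel \<Longrightarrow> B \<subseteq> A \<Longrightarrow> \<mu> B \<le> c" for \<mu> c
  proof -
    interpret finite_measure "pos_variation \<mu>" by (rule finite_measure_pos_variation[OF that(1)])
    have "0 \<le> c" using c[of "{}"] that(1) by (simp add: ca_def)
    have "emeasure (pos_variation \<mu>) A \<le> ennreal c"
      unfolding emeasure_pos_variation[OF that(1) A] using c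
      by (intro SUP_least ennreal_leI) auto
    then show ?thesis using \<open>0 \<le> c\<close> by (simp add: emeasure_eq_measure)
  qed
  have "measure (pos_variation \<mu>) A \<le> \<mu> A + measure (neg_variation \<mu>) A"
  proof (rule p_least[OF mu])
    fix B assume B: "B \<in> sets borel" "B \<subseteq> A"
    have "- \<mu> (A - B) \<le> measure (neg_variation \<mu>) A"
      unfolding neg_variation_def using A B by (intro p_up[OF ca_uminus[OF mu]]) auto
    then show "\<mu> B \<le> \<mu> A + measure (neg_variation \<mu>) A"
      using ca_Diff[OF mu A B] by simp
  qed
  moreover have "measure (neg_variation \<mu>) A \<le> measure (pos_variation \<mu>) A - \<mu> A"
    unfolding neg_variation_def
  proof (rule p_least[OF ca_uminus[OF mu]])
    fix B assume B: "B \<in> sets borel" "B \<subseteq> A"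
    have "\<mu> (A - B) \<le> measure (pos_variation \<mu>) A"
      using A B by (intro p_up[OF mu]) auto
    then show "- \<mu> B \<le> measure (pos_variation \<mu>) A - \<mu> A"
      using ca_Diff[OF mu A B] by simp
  qed
  ultimately show ?thesis by simp
qed

lemma integrable_ucb:
  assumes "finite_measure M" "sets M = sets borel"
  shows "integrable M (apply_ucb f)"
proof -
  interpret finite_measure M by fact
  have "apply_ucb f \<in> borel_measurable borel"
    by (rule borel_measurable_continuous_onI[OF ucb_continuous])
  then have "apply_ucb f \<in> borel_measurable M"
    using measurable_cong_sets[OF assms(2) refl] by blast
  then show ?thesis
    by (rule integrable_const_bound[of _ "norm f", rotated])
      (simp add: abs_apply_ucb_le_norm)
qed

lemma linear_signed_integral:
  assumes mu: "\<mu> \<in> ca"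
  shows "linear (\<lambda>f::'a::metric_space ucb. signed_integral \<mu> (apply_ucb f))"
proof -
  have "integrable (pos_variation \<mu>) (apply_ucb f)" "integrable (neg_variation \<mu>) (apply_ucb f)"
    for f :: "'a ucb"
    using finite_measure_pos_variation[OF mu] finite_measure_neg_variation[OF mu]
    by (auto intro!: integrable_ucb)
  then show ?thesis
    by (intro linearI) (auto simp: signed_integral_def algebra_simps)
qed


section \<open>Locally convex spaces and weak topologies\<close>

definition hausdorff_locally_convex :: "'x::real_vector topology \<Rightarrow> bool" where
  "hausdorff_locally_convex X \<longleftrightarrow>
     topspace X = UNIV \<and> Hausdorff_space X \<and>
     continuous_map (prod_topology X X) X (\<lambda>(x, y). x + y) \<and>
     continuous_map (prod_topology euclideanreal X) X (\<lambda>(c, x). c *\<^sub>R x) \<and>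
     (\<forall>U. openin X U \<and> 0 \<in> U \<longrightarrow> (\<exists>V. openin X V \<and> 0 \<in> V \<and> convex V \<and> V \<subseteq> U))"

definition von_neumann_bounded :: "'x::real_vector topology \<Rightarrow> 'x set \<Rightarrow> bool" where
  "von_neumann_bounded X B \<longleftrightarrow>
     (\<forall>U. openin X U \<and> 0 \<in> U \<longrightarrow> (\<exists>r>0. \<forall>s\<ge>r. B \<subseteq> (\<lambda>x. s *\<^sub>R x) ` U))"

definition sequentially_continuous_map :: "'x topology \<Rightarrow> 'y topology \<Rightarrow> ('x \<Rightarrow> 'y) \<Rightarrow> bool" where
  "sequentially_continuous_map X Y f \<longleftrightarrow>
     (\<forall>x l. limitin X x l sequentially \<longrightarrow> limitin Y (\<lambda>n. f (x n)) (f l) sequentially)"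

text \<open>The initial topology of \<open>F\<close>. For a separating set of linear functionals it is Hausdorff and
  locally convex, hence also the weakest locally convex topology making all members of \<open>F\<close>
  continuous; see the lemmas below. Inserting \<open>UNIV\<close> only matters for \<open>F = {}\<close>.\<close>

definition weak_topology :: "('x \<Rightarrow> real) set \<Rightarrow> 'x topology" where
  "weak_topology F = topology_generated_by (insert UNIV {\<phi> -` U | \<phi> U. \<phi> \<in> F \<and> open U})"

lemma topspace_weak_topology [simp]: "topspace (weak_topology F) = UNIV"
  by (simp add: weak_topology_def)

lemma continuous_map_weak_topology_iff:
  "continuous_map Y (weak_topology F) f \<longleftrightarrow> (\<forall>\<phi>\<in>F. continuous_map Y euclideanreal (\<lambda>x. \<phi> (f x)))"
proof -
  have eq: "f -` (\<phi> -` U) \<inter> topspace Y = {x \<in> topspace Y. \<phi> (f x) \<in> U}" for \<phi> :: "_ \<Rightarrow> real" and U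
    by auto
  have "continuous_map Y (weak_topology F) f \<longleftrightarrow>
      (\<forall>\<phi>\<in>F. \<forall>U. open U \<longrightarrow> openin Y (f -` (\<phi> -` U) \<inter> topspace Y))"
    unfolding weak_topology_def continuous_on_generated_topo_iff by auto
  also have "\<dots> \<longleftrightarrow> (\<forall>\<phi>\<in>F. continuous_map Y euclideanreal (\<lambda>x. \<phi> (f x)))"
    unfolding eq by (simp add: continuous_map_def)
  finally show ?thesis .
qed

lemma continuous_map_weak_topology: "\<phi> \<in> F \<Longrightarrow> continuous_map (weak_topology F) euclideanreal \<phi>"
  using continuous_map_weak_topology_iff[of "weak_topology F" F "\<lambda>x. x"] by simp

lemma weak_topology_weakest:
  assumes "topspace X = UNIV" "\<And>\<phi>. \<phi> \<in> F \<Longrightarrow> continuous_map X euclideanreal \<phi>"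
    and "openin (weak_topology F) U"
  shows "openin X U"
proof -
  have "continuous_map X (weak_topology F) (\<lambda>x. x)"
    using assms(2) by (simp add: continuous_map_weak_topology_iff)
  then show ?thesis
    using openin_continuous_map_preimage[OF _ assms(3), of X "\<lambda>x. x"] assms(1) by simp
qed

lemma hausdorff_locally_convex_weak_topology:
  fixes F :: "('x::real_vector \<Rightarrow> real) set"
  assumes lin: "\<And>\<phi>. \<phi> \<in> F \<Longrightarrow> linear \<phi>"
    and sep: "\<And>x. (\<And>\<phi>. \<phi> \<in> F \<Longrightarrow> \<phi> x = 0) \<Longrightarrow> x = 0"
  shows "hausdorff_locally_convex (weak_topology F)"
proof -
  let ?X = "weak_topology F"
  have "Hausdorff_space ?X"
    unfolding Hausdorff_space_def
  proof (intro allI impI)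
    fix x y assume "x \<in> topspace ?X \<and> y \<in> topspace ?X \<and> x \<noteq> y"
    then have "x - y \<noteq> 0" by simp
    then obtain \<phi> where phi: "\<phi> \<in> F" "\<phi> (x - y) \<noteq> 0" using sep by blast
    then have "\<phi> x \<noteq> \<phi> y" by (simp add: linear_diff[OF lin])
    then obtain U V where UV: "open U" "open V" "\<phi> x \<in> U" "\<phi> y \<in> V" "U \<inter> V = {}"
      by (metis hausdorff)
    have "openin ?X (\<phi> -` W)" if "open W" for W
      unfolding weak_topology_def using that phi(1) by (intro topology_generated_by_Basis) auto
    then show "\<exists>U V. openin ?X U \<and> openin ?X V \<and> x \<in> U \<and> y \<in> V \<and> disjnt U V"
      using UV by (intro exI[of _ "\<phi> -` U"] exI[of _ "\<phi> -` V"]) (auto simp: disjnt_def)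
  qed
  moreover have "continuous_map (prod_topology ?X ?X) ?X (\<lambda>(x, y). x + y)"
    unfolding continuous_map_weak_topology_iff
  proof
    fix \<phi> assume phi: "\<phi> \<in> F"
    have "continuous_map (prod_topology ?X ?X) euclideanreal (\<lambda>z. \<phi> (fst z) + \<phi> (snd z))"
      by (intro continuous_intros
          continuous_map_compose[OF continuous_map_fst continuous_map_weak_topology[OF phi], unfolded o_def]
          continuous_map_compose[OF continuous_map_snd continuous_map_weak_topology[OF phi], unfolded o_def])
    then show "continuous_map (prod_topology ?X ?X) euclideanreal (\<lambda>z. \<phi> (case z of (x, y) \<Rightarrow> x + y))"
      by (simp add: case_prod_beta linear_add[OF lin[OF phi]])
  qed
  moreover have "continuous_map (prod_topology euclideanreal ?X) ?X (\<lambda>(c, x). c *\<^sub>R x)"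
    unfolding continuous_map_weak_topology_iff
  proof
    fix \<phi> assume phi: "\<phi> \<in> F"
    have "continuous_map (prod_topology euclideanreal ?X) euclideanreal (\<lambda>z. fst z * \<phi> (snd z))"
      by (intro continuous_map_real_mult continuous_map_fst
          continuous_map_compose[OF continuous_map_snd continuous_map_weak_topology[OF phi], unfolded o_def])
    then show "continuous_map (prod_topology euclideanreal ?X) euclideanreal
        (\<lambda>z. \<phi> (case z of (c, x) \<Rightarrow> c *\<^sub>R x))"
      by (simp add: case_prod_beta linear_cmul[OF lin[OF phi]])
  qed
  moreover have "\<exists>V. openin ?X V \<and> x \<in> V \<and> convex V \<and> V \<subseteq> U" if "openin ?X U" "x \<in> U" for U x
  proof -
    from that(1) have "generate_topology_on (insert UNIV {\<phi> -` U | \<phi> U. \<phi> \<in> F \<and> open U}) U"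
      unfolding weak_topology_def by (rule openin_topology_generated_by)
    then show ?thesis
      using that(2)
    proof (induction U)
      case (Int A B)
      then obtain V W where "openin ?X V \<and> x \<in> V \<and> convex V \<and> V \<subseteq> A"
        "openin ?X W \<and> x \<in> W \<and> convex W \<and> W \<subseteq> B" by blast
      then show ?case by (intro exI[of _ "V \<inter> W"]) (auto intro: convex_Int openin_Int)
    next
      case (UN K)
      then show ?case by (meson UnionE Union_upper subset_trans)
    next
      case (Basis S)
      then consider "S = UNIV" | \<phi> W where "S = \<phi> -` W" "\<phi> \<in> F" "open W" by blast
      then show ?case
      proof cases
        case 1
        have "openin ?X UNIV" using openin_topspace[of ?X] by simp
        then show ?thesis using 1 by (intro exI[of _ UNIV]) auto
      next
        case 2
        then obtain e where e: "e > 0" "ball (\<phi> x) e \<subseteq> W"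
          using Basis.prems by (auto elim: openE)
        have "openin ?X (\<phi> -` ball (\<phi> x) e)"
          unfolding weak_topology_def using 2 by (intro topology_generated_by_Basis) auto
        moreover have "convex (\<phi> -` ball (\<phi> x) e)"
          by (intro convex_linear_vimage lin 2 convex_ball)
        ultimately show ?thesis
          using e 2 by (intro exI[of _ "\<phi> -` ball (\<phi> x) e"]) auto
      qed
    qed auto
  qed
  ultimately show ?thesis
    unfolding hausdorff_locally_convex_def by auto
qed

text \<open>The topology \<open>\<sigma>(UC\<^sub>b(E), ca(E))\<close>.\<close>

definition sigma_ucb_ca :: "'a::metric_space ucb topology" where
  "sigma_ucb_ca = weak_topology {\<lambda>f. signed_integral \<mu> (apply_ucb f) | \<mu>. \<mu> \<in> ca}"

lemma dirac_in_ca: "(\<lambda>A. indicat_real A x) \<in> ca"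
proof -
  have "(\<lambda>n. indicat_real (A n) x) sums indicat_real (\<Union>n. A n) x"
    if "disjoint_family A" for A :: "nat \<Rightarrow> _ set"
  proof (cases "\<exists>k. x \<in> A k")
    case True
    then obtain k where k: "x \<in> A k" by blast
    then have "x \<notin> A n" if "n \<noteq> k" for n
      using \<open>disjoint_family A\<close> that by (auto simp: disjoint_family_on_def)
    then have "(\<lambda>n. indicat_real (A n) x) sums (\<Sum>n\<in>{k}. indicat_real (A n) x)"
      by (intro sums_finite) auto
    then show ?thesis using k by (auto simp: indicator_def split: if_splits)
  qed (auto simp: indicator_def)
  then show ?thesis by (auto simp: ca_def)
qed

lemma signed_integral_dirac:
  fixes f :: "'a::metric_space ucb"
  shows "signed_integral (\<lambda>A. indicat_real A x) (apply_ucb f) = apply_ucb f x"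
proof -
  let ?d = "\<lambda>A. indicat_real A x"
  let ?p = "pos_variation ?d" and ?n = "neg_variation ?d"
  interpret p: finite_measure ?p by (rule finite_measure_pos_variation[OF dirac_in_ca])
  have n0: "emeasure ?n A = 0" if "A \<in> sets borel" for A
    unfolding neg_variation_def emeasure_pos_variation[OF ca_uminus[OF dirac_in_ca] that]
    by (intro antisym SUP_least) (auto simp: ennreal_neg)
  then have "AE y in ?n. apply_ucb f y = 0"
    by (intro AE_I[of _ _ UNIV]) auto
  then have "integral\<^sup>L ?n (apply_ucb f) = 0"
    by (rule integral_eq_zero_AE)
  moreover have "emeasure ?p (- {x}) = 0"
    by (subst emeasure_pos_variation[OF dirac_in_ca])
      (auto intro!: antisym SUP_least simp: indicator_def)
  then have "AE y in ?p. apply_ucb f y = apply_ucb f x"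
    by (intro AE_I[of _ _ "- {x}"]) auto
  then have "integral\<^sup>L ?p (apply_ucb f) = integral\<^sup>L ?p (\<lambda>_. apply_ucb f x)"
    using borel_measurable_integrable[OF integrable_ucb[OF p.finite_measure_axioms]]
    by (intro integral_cong_AE) auto
  moreover have "measure ?p UNIV = 1"
    using jordan_decomposition[OF dirac_in_ca[of x], of UNIV] n0[of UNIV]
    by (simp add: measure_def)
  ultimately show ?thesis
    by (simp add: signed_integral_def)
qed

lemma hausdorff_locally_convex_sigma_ucb_ca: "hausdorff_locally_convex sigma_ucb_ca"
  unfolding sigma_ucb_ca_def
proof (rule hausdorff_locally_convex_weak_topology)
  fix f :: "'a ucb"
  assume *: "\<And>\<phi>. \<phi> \<in> {\<lambda>f. signed_integral \<mu> (apply_ucb f) | \<mu>. \<mu> \<in> ca} \<Longrightarrow> \<phi> f = 0"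
  have "apply_ucb f x = 0" for x
  proof -
    have "signed_integral (\<lambda>A. indicat_real A x) (apply_ucb f) = 0"
      using dirac_in_ca[of x]
      by (intro *[of "\<lambda>f. signed_integral (\<lambda>A. indicat_real A x) (apply_ucb f)"]) blast
    then show ?thesis by (simp add: signed_integral_dirac)
  qed
  then show "f = 0" by (intro ucb_eqI) simp
qed (auto intro: linear_signed_integral)


section \<open>Semigroups\<close>

text \<open>A family indexed by \<open>[0, \<infinity>)\<close> is a function on \<open>real\<close> of which only the values at
  \<open>t \<ge> 0\<close> are constrained.\<close>

definition bounded_C0_seq_semigroup ::
    "'x::real_vector topology \<Rightarrow> (real \<Rightarrow> 'x \<Rightarrow> 'x) \<Rightarrow> bool" where
  "bounded_C0_seq_semigroup X T \<longleftrightarrow>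
     hausdorff_locally_convex X \<and>
     (\<forall>t\<ge>0. linear (T t) \<and> sequentially_continuous_map X X (T t)) \<and>
     T 0 = id \<and>
     (\<forall>t\<ge>0. \<forall>s\<ge>0. T (t + s) = T t \<circ> T s) \<and>
     (\<forall>x. continuous_map (top_of_set {0..}) X (\<lambda>t. T t x) \<and>
          von_neumann_bounded X ((\<lambda>t. T t x) ` {0..}))"

definition exp_bound :: "(real \<Rightarrow> 'x::real_normed_vector \<Rightarrow> 'x) \<Rightarrow> real \<Rightarrow> real \<Rightarrow> bool" where
  "exp_bound T M \<alpha> \<longleftrightarrow> (\<forall>t\<ge>0. \<forall>f. norm (T t f) \<le> M * exp (\<alpha> * t) * norm f)"

definition pi_semigroup :: "(real \<Rightarrow> 'a::metric_space ucb \<Rightarrow> 'a ucb) \<Rightarrow> bool" where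
  "pi_semigroup T \<longleftrightarrow>
     (\<forall>t\<ge>0. bounded_linear (T t)) \<and>
     T 0 = id \<and>
     (\<forall>t\<ge>0. \<forall>s\<ge>0. T t \<circ> T s = T (t + s)) \<and>
     (\<exists>M\<ge>1. \<exists>\<alpha>. exp_bound T M \<alpha>) \<and>
     (\<forall>\<xi> f. continuous_on {0..} (\<lambda>t. apply_ucb (T t f) \<xi>)) \<and>
     (\<forall>(f :: nat \<Rightarrow> 'a ucb) g.
        bdd_above (range (\<lambda>n. norm (f n))) \<longrightarrow>
        (\<forall>x. (\<lambda>n. apply_ucb (f n) x) \<longlonglongrightarrow> apply_ucb g x) \<longrightarrow>
        (\<forall>t\<ge>0. \<forall>x. (\<lambda>n. apply_ucb (T t (f n)) x) \<longlonglongrightarrow> apply_ucb (T t g) x))"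

end

theory Submission
  imports Defs
begin

text \<open>Write \<open>S\<^sub>t = e\<^sup>-\<^sup>\<alpha>\<^sup>t T\<^sub>t\<close>. The equivalence rests on a description of \<open>\<sigma>(UC\<^sub>b(E), ca(E))\<close> in terms of
  the sup-norm and pointwise evaluation: a set is bounded for \<open>\<sigma>\<close> exactly when it is bounded in
  norm (\<open>von_neumann_bounded_sigma_iff\<close>), a sequence converges for \<open>\<sigma>\<close> exactly when it is norm
  bounded and converges pointwise (\<open>limitin_sigma_iff\<close>), and a norm-bounded function of a real
  variable is continuous for \<open>\<sigma>\<close> exactly when its evaluations at points are
  (\<open>continuous_map_sigma_iff\<close>). Pointwise convergence of bounded sequences gives convergence of
  all integrals by dominated convergence; conversely, evaluation at \<open>x\<close> is the integral against
  the Dirac measure at \<open>x\<close>. That \<open>\<sigma>\<close>-boundedness implies norm boundedness is a uniform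
  boundedness principle, tested on the measures \<open>\<Sum>\<^sub>n 4\<^sup>-\<^sup>n \<delta>(x\<^sub>n)\<close>.

  With this dictionary, continuity of \<open>T\<^sub>t\<close> under bounded pointwise convergence together with the
  norm bound says that \<open>S\<^sub>t\<close> is sequentially continuous for \<open>\<sigma>\<close>, and pointwise continuity in \<open>t\<close>
  says that the orbits of \<open>S\<close>, which are bounded by \<open>M |f|\<close>, are \<open>\<sigma>\<close>-continuous.
  This is the passage from a \<open>\<pi>\<close>-semigroup to a bounded
  \<open>C\<^sub>0\<close>-sequentially continuous semigroup. In the other direction everything translates back in
  the same way except for the bound \<open>|S\<^sub>t f| \<le> M |f|\<close> with \<open>M\<close> independent of \<open>t\<close> and \<open>f\<close>: the
  hypothesis only gives a norm bound on each orbit. The uniform bound is the Banach-Steinhaus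
  theorem (\<open>sigma_pointwise_bounded_imp_uniformly_bounded\<close>), which here also yields the norm
  continuity of each \<open>S\<^sub>t\<close>, since \<open>\<sigma>\<close>-sequential continuity suffices to apply \<open>S\<^sub>t\<close> to a
  norm-convergent series term by term.

  Both uniform boundedness arguments, on measures and on functions, are instances of a single
  gliding hump lemma (\<open>gliding_hump_bounded\<close>) about sets of real functions.\<close>

section \<open>A gliding hump\<close>

text \<open>If \<open>\<Phi>\<close> is not uniformly bounded on \<open>D\<close>, one can choose \<open>\<phi>\<^sub>n \<in> \<Phi>\<close> and \<open>x\<^sub>n \<in> D\<close> so that in
  \<open>\<Sum>\<^sub>k 4\<^sup>-\<^sup>k \<phi>\<^sub>n(x\<^sub>k)\<close> the term \<open>k = n\<close> dominates: the earlier terms are bounded uniformly in \<open>\<phi>\<^sub>n\<close>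
  because \<open>\<Phi>\<close> is bounded at each single point, and the later ones add up to at most half of the
  dominating term if \<open>|\<phi>\<^sub>n|\<close> is almost maximal at \<open>x\<^sub>n\<close>. The sums are then unbounded in \<open>n\<close>.
  A vector \<open>\<Sum>\<^sub>k 4\<^sup>-\<^sup>k x\<^sub>k\<close> enters only through the values that it would
  have under \<open>\<Phi>\<close>, so \<open>D\<close> may be the set of points of \<open>E\<close> as well as a set of functions.\<close>

lemma gliding_hump_bounded:
  fixes \<Phi> :: "('b \<Rightarrow> real) set" and D :: "'b set"
  assumes series: "\<And>x :: nat \<Rightarrow> 'b. range x \<subseteq> D \<Longrightarrow>
    \<exists>K. \<forall>\<phi>\<in>\<Phi>. summable (\<lambda>n. (1/4)^n * \<phi> (x n)) \<and> \<bar>\<Sum>n. (1/4)^n * \<phi> (x n)\<bar> \<le> K"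
  shows "\<exists>K. \<forall>\<phi>\<in>\<Phi>. \<forall>x\<in>D. \<bar>\<phi> x\<bar> \<le> K"
proof (rule ccontr)
  assume unbounded: "\<not> ?thesis"
  \<comment> \<open>For an unbounded \<open>\<phi>\<close> some sequence has \<open>|\<phi>(x\<^sub>n)| > 4\<^sup>n\<close>, so that the series diverges.\<close>
  have "\<exists>K. \<forall>x\<in>D. \<bar>\<phi> x\<bar> \<le> K" if phi: "\<phi> \<in> \<Phi>" for \<phi>
  proof (rule ccontr)
    assume "\<not> ?thesis"
    then have "\<exists>x. x \<in> D \<and> \<bar>\<phi> x\<bar> > 4^n" for n :: nat
      by (meson not_le)
    then obtain x :: "nat \<Rightarrow> 'b" where x: "\<And>n. x n \<in> D" "\<And>n. \<bar>\<phi> (x n)\<bar> > 4^n" by metis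
    then have "summable (\<lambda>n. (1/4)^n * \<phi> (x n))"
      using series[of x] phi by blast
    then have "(\<lambda>n. (1/4)^n * \<phi> (x n)) \<longlonglongrightarrow> 0" by (rule summable_LIMSEQ_zero)
    then obtain n where "\<bar>(1/4)^n * \<phi> (x n)\<bar> < 1"
      by (auto simp: lim_sequentially dest!: spec[of _ "1::real"])
    with x(2)[of n] show False by (simp add: abs_mult power_divide field_simps)
  qed
  then obtain L where L: "\<And>\<phi> x. \<phi> \<in> \<Phi> \<Longrightarrow> x \<in> D \<Longrightarrow> \<bar>\<phi> x\<bar> \<le> L \<phi>"
    by metis
  \<comment> \<open>Constant sequences give boundedness of \<open>\<Phi>\<close> at each point.\<close>
  have "\<exists>K. \<forall>\<phi>\<in>\<Phi>. \<bar>\<phi> x\<bar> \<le> K" if x: "x \<in> D" for x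
  proof -
    have geo: "(\<lambda>n. (1/4)^n * \<phi> x) sums (4/3 * \<phi> x)" for \<phi> :: "'b \<Rightarrow> real"
      using sums_mult2[OF geometric_sums[of "1/4::real"], of "\<phi> x"] by simp
    obtain K where K: "\<And>\<phi>. \<phi> \<in> \<Phi> \<Longrightarrow> \<bar>\<Sum>n. (1/4)^n * \<phi> x\<bar> \<le> K"
      using series[of "\<lambda>_. x"] x by auto
    have "\<bar>\<phi> x\<bar> \<le> K" if "\<phi> \<in> \<Phi>" for \<phi>
      using K[OF that] sums_unique[OF geo[of \<phi>]] by (simp add: abs_mult)
    then show ?thesis by blast
  qed
  then obtain G where G: "\<And>\<phi> x. \<phi> \<in> \<Phi> \<Longrightarrow> x \<in> D \<Longrightarrow> \<bar>\<phi> x\<bar> \<le> G x"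
    by metis
  have peak: "\<exists>\<phi> x. \<phi> \<in> \<Phi> \<and> x \<in> D \<and> (\<forall>y\<in>D. \<bar>\<phi> y\<bar> \<le> 3/2 * \<bar>\<phi> x\<bar>) \<and> C \<le> \<bar>\<phi> x\<bar>" for C
  proof -
    obtain \<phi> z where z: "\<phi> \<in> \<Phi>" "z \<in> D" "\<bar>\<phi> z\<bar> > 3/2 * \<bar>C\<bar>"
      using unbounded by (meson not_le)
    define S where "S = (SUP y\<in>D. \<bar>\<phi> y\<bar>)"
    have bdd: "bdd_above ((\<lambda>y. \<bar>\<phi> y\<bar>) ` D)"
      using L[OF z(1)] by (auto simp: bdd_above_def)
    have up: "\<bar>\<phi> y\<bar> \<le> S" if "y \<in> D" for y
      unfolding S_def using that bdd by (rule cSUP_upper)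
    have "2/3 * S < S" using up[OF z(2)] z(3) by linarith
    then obtain x where x: "x \<in> D" "2/3 * S < \<bar>\<phi> x\<bar>"
      unfolding S_def using less_cSUP_iff[OF _ bdd] z(2) by blast
    have "\<forall>y\<in>D. \<bar>\<phi> y\<bar> \<le> 3/2 * \<bar>\<phi> x\<bar>" using up x(2) by fastforce
    moreover have "C \<le> \<bar>\<phi> x\<bar>" using up[OF z(2)] z(3) x(2) by linarith
    ultimately show ?thesis using z(1) x(1) by blast
  qed
  \<comment> \<open>The third component \<open>A\<close> of a state bounds the terms before the hump; carrying it along makes
    the choice at step \<open>n\<close> depend on the previous state alone. The factor \<open>2\<close> leaves room for
    the terms after the hump, which are at most \<open>3/2 \<cdot> (4\<^sup>-\<^sup>n\<^sup>-\<^sup>1 + 4\<^sup>-\<^sup>n\<^sup>-\<^sup>2 + \<dots>) = 4\<^sup>-\<^sup>n / 2\<close> times the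
    value at the peak.\<close>
  define P where "P n = (\<lambda>(\<phi>, x, A). \<phi> \<in> \<Phi> \<and> x \<in> D \<and> (\<forall>y\<in>D. \<bar>\<phi> y\<bar> \<le> 3/2 * \<bar>\<phi> x\<bar>) \<and>
      2 * 4^n * (real n + A) \<le> \<bar>\<phi> x\<bar>)" for n :: nat
  define Q where "Q n s s' \<longleftrightarrow> snd (snd s') = snd (snd s) + (1/4)^n * G (fst (snd s))"
    for n :: nat and s s' :: "('b \<Rightarrow> real) \<times> 'b \<times> real"
  have ex: "\<exists>\<phi> x. P n (\<phi>, x, A)" for n A
    using peak[of "2 * 4^n * (real n + A)"] unfolding P_def by simp
  have "\<exists>s. \<forall>n. (P n (s n) \<and> (n = 0 \<longrightarrow> snd (snd (s n)) = 0)) \<and> Q n (s n) (s (Suc n))"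
  proof (rule dependent_nat_choice)
    show "\<exists>s. P 0 s \<and> (0 = (0::nat) \<longrightarrow> snd (snd s) = 0)"
      using ex[of 0 0] by force
    show "\<exists>s'. (P (Suc n) s' \<and> (Suc n = 0 \<longrightarrow> snd (snd s') = 0)) \<and> Q n s s'" for s n
      using ex[of "Suc n" "snd (snd s) + (1/4)^n * G (fst (snd s))"] unfolding Q_def by force
  qed
  then obtain s where s: "\<And>n. P n (s n)" "\<And>n. Q n (s n) (s (Suc n))" "snd (snd (s 0)) = 0"
    by metis
  define \<phi> where "\<phi> n = fst (s n)" for n
  define x where "x n = fst (snd (s n))" for n
  have A: "snd (snd (s n)) = (\<Sum>k<n. (1/4)^k * G (x k))" for n
    by (induction n) (use s(2,3) in \<open>auto simp: Q_def x_def\<close>)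
  have phi: "\<phi> n \<in> \<Phi>" and xD: "x n \<in> D" for n
    using s(1)[of n] by (auto simp: P_def \<phi>_def x_def split: prod.splits)
  have near: "\<bar>\<phi> n y\<bar> \<le> 3/2 * \<bar>\<phi> n (x n)\<bar>" if "y \<in> D" for n y
    using s(1)[of n] that by (auto simp: P_def \<phi>_def x_def split: prod.splits)
  have large: "2 * 4^n * (real n + (\<Sum>k<n. (1/4)^k * G (x k))) \<le> \<bar>\<phi> n (x n)\<bar>" for n
    using s(1)[of n] unfolding A[symmetric] by (auto simp: P_def \<phi>_def x_def split: prod.splits)
  have "range x \<subseteq> D" using xD by auto
  from series[OF this] obtain K where K: "\<forall>\<phi>\<in>\<Phi>. summable (\<lambda>n. (1/4)^n * \<phi> (x n)) \<and>
      \<bar>\<Sum>n. (1/4)^n * \<phi> (x n)\<bar> \<le> K" by (rule exE)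
  have "real n \<le> K" for n
  proof -
    let ?a = "\<lambda>k. (1/4)^k * \<phi> n (x k)"
    let ?b = "\<bar>\<phi> n (x n)\<bar>"
    have sm: "summable ?a" using K phi by simp
    have "(\<Sum>k. ?a k) = (\<Sum>k. ?a (k + Suc n)) + (\<Sum>k<Suc n. ?a k)"
      by (rule suminf_split_initial_segment[OF sm])
    then have split: "?a n = (\<Sum>k. ?a k) - (\<Sum>k<n. ?a k) - (\<Sum>k. ?a (k + Suc n))"
      by simp
    have head: "\<bar>\<Sum>k<n. ?a k\<bar> \<le> (\<Sum>k<n. (1/4)^k * G (x k))"
      by (rule order_trans[OF sum_abs]) (auto intro!: sum_mono mult_left_mono G phi xD simp: abs_mult)
    have geo: "(\<lambda>k. (1/4)^k * ((1/4)^Suc n * (3/2 * ?b))) sums (4/3 * ((1/4)^Suc n * (3/2 * ?b)))"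
      using sums_mult2[OF geometric_sums[of "1/4::real"], of "(1/4)^Suc n * (3/2 * ?b)"]
      by (simp del: times_divide_eq_left)
    have le: "\<bar>?a (k + Suc n)\<bar> \<le> (1/4)^k * ((1/4)^Suc n * (3/2 * ?b))" for k
      using near[OF xD, of n "k + Suc n"] by (simp add: abs_mult power_add)
    have "\<bar>\<Sum>k. ?a (k + Suc n)\<bar> \<le> (\<Sum>k. (1/4)^k * ((1/4)^Suc n * (3/2 * ?b)))"
      using norm_suminf_le[of "\<lambda>k. ?a (k + Suc n)", OF _ sums_summable[OF geo]] le by simp
    also have "\<dots> = 4/3 * ((1/4)^Suc n * (3/2 * ?b))"
      by (rule sums_unique[OF geo, symmetric])
    also have "\<dots> = (1/4)^n * ?b / 2" by simp
    finally have tail: "\<bar>\<Sum>k. ?a (k + Suc n)\<bar> \<le> (1/4)^n * ?b / 2" .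
    have main: "\<bar>?a n\<bar> = (1/4)^n * ?b" by (simp add: abs_mult)
    have "real n + (\<Sum>k<n. (1/4)^k * G (x k)) \<le> (1/4)^n * ?b / 2"
      using large[of n] by (simp add: power_divide field_simps)
    then show ?thesis
      using split main head tail bspec[OF K phi[of n]] by linarith
  qed
  then show False
    using reals_Archimedean2[of K] by (meson not_less)
qed


section \<open>Convergence and boundedness in a weak topology\<close>

text \<open>Convergence and boundedness both reduce to the functionals because only finitely many of
  them are involved in a neighbourhood.\<close>

lemma weak_topology_basic_nbhd:
  assumes "openin (weak_topology F) U" "x \<in> U"
  obtains G e where "finite G" "G \<subseteq> F" "e > 0" "{y. \<forall>\<phi>\<in>G. \<bar>\<phi> y - \<phi> x\<bar> < e} \<subseteq> U"
proof -
  have "generate_topology_on (insert UNIV {\<phi> -` U | \<phi> U. \<phi> \<in> F \<and> open U}) U"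
    using assms(1) unfolding weak_topology_def by (rule openin_topology_generated_by)
  then have "\<exists>G e. finite G \<and> G \<subseteq> F \<and> e > 0 \<and> {y. \<forall>\<phi>\<in>G. \<bar>\<phi> y - \<phi> x\<bar> < e} \<subseteq> U"
    using assms(2)
  proof (induction U)
    case (Int A B)
    from Int.prems have x: "x \<in> A" "x \<in> B" by simp_all
    obtain G e where G:
      "finite G" "G \<subseteq> F" "e > 0" "{y. \<forall>\<phi>\<in>G. \<bar>\<phi> y - \<phi> x\<bar> < e} \<subseteq> A"
      using Int.IH(1)[OF x(1)] by blast
    obtain H d where H:
      "finite H" "H \<subseteq> F" "d > 0" "{y. \<forall>\<phi>\<in>H. \<bar>\<phi> y - \<phi> x\<bar> < d} \<subseteq> B"
      using Int.IH(2)[OF x(2)] by blast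
    from G H show ?case
      by (intro exI[of _ "G \<union> H"] exI[of _ "min e d"]) auto
  next
    case (UN K)
    then show ?case by (meson UnionE Union_upper subset_trans)
  next
    case (Basis S)
    then consider "S = UNIV" | \<phi> W where "S = \<phi> -` W" "\<phi> \<in> F" "open W" by blast
    then show ?case
    proof cases
      case 1
      then show ?thesis by (intro exI[of _ "{}"] exI[of _ 1]) auto
    next
      case 2
      then obtain e where "e > 0" "ball (\<phi> x) e \<subseteq> W"
        using Basis.prems by (auto elim: openE)
      then show ?thesis
        using 2 by (intro exI[of _ "{\<phi>}"] exI[of _ e]) (auto simp: subset_iff dist_real_def abs_minus_commute)
    qed
  qed auto
  then show ?thesis using that by blast
qed

lemma openin_weak_topology_vimage:
  "\<phi> \<in> F \<Longrightarrow> open U \<Longrightarrow> openin (weak_topology F) (\<phi> -` U)"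
  unfolding weak_topology_def by (intro topology_generated_by_Basis) auto

lemma limitin_weak_topology_iff:
  "limitin (weak_topology F) x l sequentially \<longleftrightarrow> (\<forall>\<phi>\<in>F. (\<lambda>n. \<phi> (x n)) \<longlonglongrightarrow> \<phi> l)"
proof
  assume lim: "limitin (weak_topology F) x l sequentially"
  show "\<forall>\<phi>\<in>F. (\<lambda>n. \<phi> (x n)) \<longlonglongrightarrow> \<phi> l"
    using continuous_map_limit[OF continuous_map_weak_topology lim] by (simp add: o_def)
next
  assume lim: "\<forall>\<phi>\<in>F. (\<lambda>n. \<phi> (x n)) \<longlonglongrightarrow> \<phi> l"
  show "limitin (weak_topology F) x l sequentially"
    unfolding limitin_def
  proof (intro conjI allI impI)
    fix U assume "openin (weak_topology F) U \<and> l \<in> U"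
    then have U: "openin (weak_topology F) U" "l \<in> U" by simp_all
    obtain G e where G: "finite G" "G \<subseteq> F" "e > 0" "{y. \<forall>\<phi>\<in>G. \<bar>\<phi> y - \<phi> l\<bar> < e} \<subseteq> U"
      by (rule weak_topology_basic_nbhd[OF U])
    have "\<forall>\<phi>\<in>G. \<forall>\<^sub>F n in sequentially. \<bar>\<phi> (x n) - \<phi> l\<bar> < e"
      using lim G(2,3) by (auto simp: dist_real_def dest!: tendstoD)
    then have "\<forall>\<^sub>F n in sequentially. \<forall>\<phi>\<in>G. \<bar>\<phi> (x n) - \<phi> l\<bar> < e"
      by (rule eventually_ball_finite[OF G(1)])
    then show "\<forall>\<^sub>F n in sequentially. x n \<in> U"
      by eventually_elim (use G(4) in blast)
  qed simp
qed

lemma von_neumann_bounded_weak_topology_iff: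
  fixes F :: "('x::real_vector \<Rightarrow> real) set"
  assumes lin: "\<And>\<phi>. \<phi> \<in> F \<Longrightarrow> linear \<phi>"
  shows "von_neumann_bounded (weak_topology F) B \<longleftrightarrow> (\<forall>\<phi>\<in>F. \<exists>K. \<forall>b\<in>B. \<bar>\<phi> b\<bar> \<le> K)"
proof
  assume B: "von_neumann_bounded (weak_topology F) B"
  show "\<forall>\<phi>\<in>F. \<exists>K. \<forall>b\<in>B. \<bar>\<phi> b\<bar> \<le> K"
  proof
    fix \<phi> assume phi: "\<phi> \<in> F"
    have "openin (weak_topology F) (\<phi> -` ball 0 1)" "0 \<in> \<phi> -` ball 0 1"
      using openin_weak_topology_vimage[OF phi open_ball] linear_0[OF lin[OF phi]] by auto
    with B have "\<exists>r>0. \<forall>s\<ge>r. B \<subseteq> (\<lambda>x. s *\<^sub>R x) ` (\<phi> -` ball 0 1)"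
      unfolding von_neumann_bounded_def by simp
    then obtain r where r: "r > 0" "B \<subseteq> (\<lambda>x. r *\<^sub>R x) ` (\<phi> -` ball 0 1)"
      by (meson order_refl)
    have "\<bar>\<phi> b\<bar> \<le> r" if "b \<in> B" for b
    proof -
      have "b \<in> (\<lambda>x. r *\<^sub>R x) ` (\<phi> -` ball 0 1)" using r(2) \<open>b \<in> B\<close> by (rule subsetD)
      then obtain y where "b = r *\<^sub>R y" "y \<in> \<phi> -` ball 0 1" by (rule imageE)
      then have y: "b = r *\<^sub>R y" "\<bar>\<phi> y\<bar> < 1" by simp_all
      have "\<bar>\<phi> b\<bar> = r * \<bar>\<phi> y\<bar>"
        using r(1) y(1) by (simp add: linear_cmul[OF lin[OF phi]] abs_mult)
      also have "\<dots> \<le> r * 1" using r(1) y(2) by (intro mult_left_mono) auto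
      finally show ?thesis by simp
    qed
    then show "\<exists>K. \<forall>b\<in>B. \<bar>\<phi> b\<bar> \<le> K" by blast
  qed
next
  assume "\<forall>\<phi>\<in>F. \<exists>K. \<forall>b\<in>B. \<bar>\<phi> b\<bar> \<le> K"
  then obtain K where K: "\<And>\<phi> b. \<phi> \<in> F \<Longrightarrow> b \<in> B \<Longrightarrow> \<bar>\<phi> b\<bar> \<le> K \<phi>" by metis
  show "von_neumann_bounded (weak_topology F) B"
    unfolding von_neumann_bounded_def
  proof (intro allI impI)
    fix U assume "openin (weak_topology F) U \<and> 0 \<in> U"
    then have U: "openin (weak_topology F) U" "0 \<in> U" by simp_all
    obtain G e where G: "finite G" "G \<subseteq> F" "e > 0" "{y. \<forall>\<phi>\<in>G. \<bar>\<phi> y - \<phi> 0\<bar> < e} \<subseteq> U"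
      by (rule weak_topology_basic_nbhd[OF U])
    define C where "C = (\<Sum>\<phi>\<in>G. \<bar>K \<phi>\<bar>)"
    have C: "\<bar>\<phi> b\<bar> \<le> C" if "\<phi> \<in> G" "b \<in> B" for \<phi> b
    proof -
      have "\<bar>\<phi> b\<bar> \<le> \<bar>K \<phi>\<bar>" using K[of \<phi> b] that G(2) by force
      also have "\<dots> \<le> C"
        unfolding C_def using that(1) by (intro member_le_sum G(1)) auto
      finally show ?thesis .
    qed
    have C0: "C \<ge> 0" by (simp add: C_def sum_nonneg)
    show "\<exists>r>0. \<forall>s\<ge>r. B \<subseteq> (\<lambda>x. s *\<^sub>R x) ` U"
    proof (intro exI[of _ "(C + 1) / e"] conjI allI impI subsetI)
      show "(C + 1) / e > 0" using C0 G(3) by simp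
      fix s b assume s: "(C + 1) / e \<le> s" and b: "b \<in> B"
      have s0: "s > 0" using s \<open>(C + 1) / e > 0\<close> by linarith
      have Cs: "C < e * s" using s G(3) by (simp add: field_simps)
      have "\<bar>\<phi> (b /\<^sub>R s) - \<phi> 0\<bar> < e" if "\<phi> \<in> G" for \<phi>
      proof -
        have l: "linear \<phi>" using lin that G(2) by blast
        have "\<bar>\<phi> (b /\<^sub>R s) - \<phi> 0\<bar> = \<bar>\<phi> b\<bar> / s"
          using s0 by (simp add: linear_cmul[OF l] linear_0[OF l] abs_mult divide_inverse mult.commute)
        also have "\<dots> < e" using C[OF that b] Cs s0 by (simp add: field_simps)
        finally show ?thesis .
      qed
      then have "b /\<^sub>R s \<in> U" using G(4) by blast
      then show "b \<in> (\<lambda>x. s *\<^sub>R x) ` U" using s0 by (intro image_eqI[of _ _ "b /\<^sub>R s"]) auto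
    qed
  qed
qed


section \<open>Integration of bounded uniformly continuous functions\<close>

text \<open>A positive measure is its own positive variation, by monotonicity.\<close>

lemma signed_integral_measure:
  fixes M :: "'a::metric_space measure" and f :: "'a ucb"
  assumes fin: "finite_measure M" and sets: "sets M = sets borel"
  shows "measure M \<in> ca" "signed_integral (measure M) (apply_ucb f) = integral\<^sup>L M (apply_ucb f)"
proof -
  interpret finite_measure M by fact
  show ca: "measure M \<in> ca"
    using finite_measure_UNION by (auto simp: ca_def sets)
  have "emeasure (neg_variation (measure M)) UNIV = 0"
    unfolding neg_variation_def emeasure_pos_variation[OF ca_uminus[OF ca] borel_open[OF open_UNIV]]
    by (intro antisym SUP_least) (auto simp: ennreal_neg)
  then have "AE y in neg_variation (measure M). apply_ucb f y = 0"
    by (intro AE_I[of _ _ UNIV]) auto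
  then have "integral\<^sup>L (neg_variation (measure M)) (apply_ucb f) = 0"
    by (rule integral_eq_zero_AE)
  moreover have "pos_variation (measure M) = M"
  proof (rule measure_eqI)
    fix A assume "A \<in> sets (pos_variation (measure M))"
    then have A: "A \<in> sets borel" by simp
    show "emeasure (pos_variation (measure M)) A = emeasure M A"
      unfolding emeasure_pos_variation[OF ca A] using A
      by (intro antisym SUP_least SUP_upper2[of A])
        (auto simp: emeasure_eq_measure sets intro!: finite_measure_mono)
  qed (simp add: sets)
  ultimately show "signed_integral (measure M) (apply_ucb f) = integral\<^sup>L M (apply_ucb f)"
    by (simp add: signed_integral_def)
qed

text \<open>The measure \<open>\<Sum>\<^sub>n c\<^sub>n \<delta>(x\<^sub>n)\<close>, obtained as the image under \<open>x\<close> of the measure on the natural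
  numbers with weights \<open>c\<close>, turns integrals into series.\<close>

lemma discrete_signed_integral:
  fixes x :: "nat \<Rightarrow> 'a::metric_space" and c :: "nat \<Rightarrow> real"
  assumes c: "summable c" "\<And>n. c n \<ge> 0"
  shows "\<exists>\<mu>\<in>ca. \<forall>f::'a ucb. (\<lambda>n. c n * apply_ucb f (x n)) sums signed_integral \<mu> (apply_ucb f)"
proof -
  define N where "N = density (count_space (UNIV :: nat set)) (\<lambda>n. ennreal (c n))"
  define M where "M = distr N borel x"
  have "emeasure N UNIV = (\<integral>\<^sup>+n. ennreal (c n) \<partial>count_space UNIV)"
    by (simp add: N_def emeasure_density)
  also have "\<dots> = (\<Sum>n. ennreal (c n))" by (rule nn_integral_count_space_nat)
  also have "\<dots> = ennreal (\<Sum>n. c n)" using c by (intro suminf_ennreal2)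
  finally have "finite_measure N"
    by (intro finite_measureI) (auto simp: N_def)
  have x: "x \<in> measurable N borel" by (simp add: N_def)
  have fin: "finite_measure M"
    unfolding M_def by (rule finite_measure.finite_measure_distr[OF \<open>finite_measure N\<close> x])
  have sets: "sets M = sets borel" by (simp add: M_def)
  have "(\<lambda>n. c n * apply_ucb f (x n)) sums integral\<^sup>L M (apply_ucb f)" for f :: "'a ucb"
  proof -
    have f: "apply_ucb f \<in> borel_measurable borel"
      by (rule borel_measurable_continuous_onI[OF ucb_continuous])
    have "integrable M (apply_ucb f)" by (rule integrable_ucb[OF fin sets])
    then have "integrable N (\<lambda>n. apply_ucb f (x n))"
      unfolding M_def by (subst (asm) integrable_distr_eq[OF x f])
    then have int: "integrable (count_space UNIV) (\<lambda>n. c n * apply_ucb f (x n))"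
      unfolding N_def using c(2) by (subst (asm) integrable_density) auto
    have "integral\<^sup>L M (apply_ucb f) = integral\<^sup>L N (\<lambda>n. apply_ucb f (x n))"
      unfolding M_def by (rule integral_distr[OF x f])
    also have "\<dots> = integral\<^sup>L (count_space UNIV) (\<lambda>n. c n * apply_ucb f (x n))"
      unfolding N_def using c(2) by (subst integral_density) auto
    finally show ?thesis
      using sums_integral_count_space_nat[OF int] by simp
  qed
  then show ?thesis
    using signed_integral_measure[OF fin sets] by (intro bexI[of _ "measure M"]) auto
qed

lemma signed_integral_tendsto:
  fixes f :: "nat \<Rightarrow> 'a::metric_space ucb"
  assumes mu: "\<mu> \<in> ca" and bound: "\<And>n. norm (f n) \<le> K"
    and lim: "\<And>x. (\<lambda>n. apply_ucb (f n) x) \<longlonglongrightarrow> apply_ucb g x"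
  shows "(\<lambda>n. signed_integral \<mu> (apply_ucb (f n))) \<longlonglongrightarrow> signed_integral \<mu> (apply_ucb g)"
proof -
  have "(\<lambda>n. integral\<^sup>L M (apply_ucb (f n))) \<longlonglongrightarrow> integral\<^sup>L M (apply_ucb g)"
    if M: "finite_measure M" "sets M = sets borel" for M :: "'a measure"
  proof (rule integral_dominated_convergence[where w = "\<lambda>_. K"])
    interpret finite_measure M by fact
    show "integrable M (\<lambda>_. K)" by simp
    show "AE x in M. norm (apply_ucb (f n) x) \<le> K" for n
      using order_trans[OF abs_apply_ucb_le_norm bound] by simp
  qed (use lim borel_measurable_integrable[OF integrable_ucb[OF M]] in auto)
  then show ?thesis
    unfolding signed_integral_def
    using finite_measure_pos_variation[OF mu] finite_measure_neg_variation[OF mu]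
    by (intro tendsto_diff) auto
qed

lemma signed_integral_bounded:
  assumes mu: "\<mu> \<in> ca"
  shows "\<exists>C\<ge>0. \<forall>f::'a::metric_space ucb. \<bar>signed_integral \<mu> (apply_ucb f)\<bar> \<le> C * norm f"
proof -
  have le: "\<bar>integral\<^sup>L M (apply_ucb f)\<bar> \<le> measure M UNIV * norm f"
    if M: "finite_measure M" "sets M = sets borel" for M :: "'a measure" and f :: "'a ucb"
  proof -
    interpret finite_measure M by fact
    have "\<bar>integral\<^sup>L M (apply_ucb f)\<bar> \<le> (\<integral>x. \<bar>apply_ucb f x\<bar> \<partial>M)"
      using integral_norm_bound[of M "apply_ucb f"] by simp
    also have "\<dots> \<le> (\<integral>x. norm f \<partial>M)"
      using integrable_ucb[OF M, of f] by (intro integral_mono) (auto simp: abs_apply_ucb_le_norm)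
    also have "\<dots> = measure M UNIV * norm f"
      using sets_eq_imp_space_eq[OF M(2)] by simp
    finally show ?thesis .
  qed
  let ?p = "pos_variation \<mu>" and ?n = "neg_variation \<mu>"
  have "\<bar>signed_integral \<mu> (apply_ucb f)\<bar> \<le> (measure ?p UNIV + measure ?n UNIV) * norm f"
    for f :: "'a ucb"
    using le[OF finite_measure_pos_variation[OF mu], of f]
      le[OF finite_measure_neg_variation[OF mu], of f]
    unfolding signed_integral_def by (simp add: distrib_right)
  then show ?thesis by (intro exI[of _ "measure ?p UNIV + measure ?n UNIV"]) auto
qed


section \<open>The topology \<open>\<sigma>(UC\<^sub>b(E), ca(E))\<close>\<close>

text \<open>The gliding hump with the points of \<open>E\<close> as \<open>D\<close>: the sums \<open>\<Sum>\<^sub>n 4\<^sup>-\<^sup>n f(x\<^sub>n)\<close> are integrals against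
  one discrete measure.\<close>

lemma norm_bounded_if_signed_integral_bounded:
  fixes B :: "'a::metric_space ucb set"
  assumes "\<And>\<mu>. \<mu> \<in> ca \<Longrightarrow> \<exists>K. \<forall>f\<in>B. \<bar>signed_integral \<mu> (apply_ucb f)\<bar> \<le> K"
  shows "\<exists>K. \<forall>f\<in>B. norm f \<le> K"
proof -
  have "\<exists>K. \<forall>\<phi>\<in>apply_ucb ` B. \<forall>x\<in>UNIV. \<bar>\<phi> x\<bar> \<le> K"
  proof (rule gliding_hump_bounded)
    fix x :: "nat \<Rightarrow> 'a"
    obtain \<mu> where mu: "\<mu> \<in> ca"
      "\<And>f::'a ucb. (\<lambda>n. (1/4)^n * apply_ucb f (x n)) sums signed_integral \<mu> (apply_ucb f)"
      using discrete_signed_integral[of "\<lambda>n. (1/4)^n" x] summable_geometric[of "1/4::real"] by auto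
    obtain K where "\<And>f. f \<in> B \<Longrightarrow> \<bar>signed_integral \<mu> (apply_ucb f)\<bar> \<le> K"
      using assms[OF mu(1)] by blast
    then show "\<exists>K. \<forall>\<phi>\<in>apply_ucb ` B. summable (\<lambda>n. (1/4)^n * \<phi> (x n)) \<and>
        \<bar>\<Sum>n. (1/4)^n * \<phi> (x n)\<bar> \<le> K"
      using mu(2) by (intro exI[of _ K]) (auto simp: sums_iff)
  qed
  then show ?thesis by (meson norm_ucb_le imageI UNIV_I)
qed

lemma von_neumann_bounded_sigma_iff:
  "von_neumann_bounded sigma_ucb_ca B \<longleftrightarrow> (\<exists>K. \<forall>f\<in>B. norm f \<le> K)"
proof -
  have "von_neumann_bounded sigma_ucb_ca B \<longleftrightarrow>
      (\<forall>\<mu>\<in>ca. \<exists>K. \<forall>f\<in>B. \<bar>signed_integral \<mu> (apply_ucb f)\<bar> \<le> K)"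
    unfolding sigma_ucb_ca_def
    by (subst von_neumann_bounded_weak_topology_iff) (auto intro: linear_signed_integral)
  moreover have "\<exists>K'. \<forall>f\<in>B. \<bar>signed_integral \<mu> (apply_ucb f)\<bar> \<le> K'"
    if K: "\<forall>f\<in>B. norm f \<le> K" and mu: "\<mu> \<in> ca" for K \<mu>
  proof -
    obtain C where C: "C \<ge> 0" "\<And>f::'a ucb. \<bar>signed_integral \<mu> (apply_ucb f)\<bar> \<le> C * norm f"
      using signed_integral_bounded[OF mu] by blast
    have "\<bar>signed_integral \<mu> (apply_ucb f)\<bar> \<le> C * K" if "f \<in> B" for f
      using C(2)[of f] mult_left_mono[OF _ C(1), of "norm f" K] K that by force
    then show ?thesis by blast
  qed
  ultimately show ?thesis
    using norm_bounded_if_signed_integral_bounded[of B] by metis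
qed

lemma limitin_sigma_iff:
  fixes f :: "nat \<Rightarrow> 'a::metric_space ucb"
  shows "limitin sigma_ucb_ca f g sequentially \<longleftrightarrow>
    bdd_above (range (\<lambda>n. norm (f n))) \<and> (\<forall>x. (\<lambda>n. apply_ucb (f n) x) \<longlonglongrightarrow> apply_ucb g x)"
proof -
  have weak: "limitin sigma_ucb_ca f g sequentially \<longleftrightarrow>
      (\<forall>\<mu>\<in>ca. (\<lambda>n. signed_integral \<mu> (apply_ucb (f n))) \<longlonglongrightarrow> signed_integral \<mu> (apply_ucb g))"
    unfolding sigma_ucb_ca_def limitin_weak_topology_iff Setcompr_eq_image by simp
  show ?thesis
  proof
    assume "limitin sigma_ucb_ca f g sequentially"
    then have lim: "(\<lambda>n. signed_integral \<mu> (apply_ucb (f n))) \<longlonglongrightarrow> signed_integral \<mu> (apply_ucb g)"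
      if "\<mu> \<in> ca" for \<mu>
      using weak that by blast
    have "\<exists>K. \<forall>h\<in>range f. norm h \<le> K"
    proof (rule norm_bounded_if_signed_integral_bounded)
      fix \<mu> :: "'a set \<Rightarrow> real" assume "\<mu> \<in> ca"
      then have "Bseq (\<lambda>n. signed_integral \<mu> (apply_ucb (f n)))"
        using lim by (intro convergent_imp_Bseq convergentI)
      then show "\<exists>K. \<forall>h\<in>range f. \<bar>signed_integral \<mu> (apply_ucb h)\<bar> \<le> K"
        by (auto simp: Bseq_def)
    qed
    moreover have "(\<lambda>n. apply_ucb (f n) x) \<longlonglongrightarrow> apply_ucb g x" for x
      using lim[OF dirac_in_ca[of x]] by (simp add: signed_integral_dirac)
    ultimately show "bdd_above (range (\<lambda>n. norm (f n))) \<and>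
        (\<forall>x. (\<lambda>n. apply_ucb (f n) x) \<longlonglongrightarrow> apply_ucb g x)"
      by (auto simp: bdd_above_def)
  next
    assume f: "bdd_above (range (\<lambda>n. norm (f n))) \<and> (\<forall>x. (\<lambda>n. apply_ucb (f n) x) \<longlonglongrightarrow> apply_ucb g x)"
    then obtain K where "\<And>n. norm (f n) \<le> K" by (auto simp: bdd_above_def)
    then show "limitin sigma_ucb_ca f g sequentially"
      unfolding weak using f signed_integral_tendsto[of _ f K g] by simp
  qed
qed

text \<open>Dominated convergence is a statement about sequences; it applies here because continuity on a
  set of reals can be tested on sequences, although \<open>\<sigma>\<close> itself need not be sequential.\<close>

lemma continuous_map_sigma_iff:
  fixes u :: "real \<Rightarrow> 'a::metric_space ucb"
  assumes bound: "\<And>t. t \<in> S \<Longrightarrow> norm (u t) \<le> K"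
  shows "continuous_map (top_of_set S) sigma_ucb_ca u \<longleftrightarrow>
    (\<forall>x. continuous_on S (\<lambda>t. apply_ucb (u t) x))"
proof -
  have weak: "continuous_map (top_of_set S) sigma_ucb_ca u \<longleftrightarrow>
      (\<forall>\<mu>\<in>ca. continuous_on S (\<lambda>t. signed_integral \<mu> (apply_ucb (u t))))"
    unfolding sigma_ucb_ca_def continuous_map_weak_topology_iff Setcompr_eq_image by simp
  show ?thesis
  proof
    assume "continuous_map (top_of_set S) sigma_ucb_ca u"
    then have "continuous_on S (\<lambda>t. signed_integral (\<lambda>A. indicat_real A x) (apply_ucb (u t)))" for x
      unfolding weak using dirac_in_ca by blast
    then show "\<forall>x. continuous_on S (\<lambda>t. apply_ucb (u t) x)"
      by (simp add: signed_integral_dirac)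
  next
    assume pt: "\<forall>x. continuous_on S (\<lambda>t. apply_ucb (u t) x)"
    show "continuous_map (top_of_set S) sigma_ucb_ca u"
      unfolding weak continuous_on_sequentially o_def
    proof (intro ballI allI impI)
      fix \<mu> :: "'a set \<Rightarrow> real" and s a
      assume mu: "\<mu> \<in> ca" and s: "a \<in> S" "(\<forall>n. s n \<in> S) \<and> s \<longlonglongrightarrow> a"
      have "(\<lambda>n. apply_ucb (u (s n)) x) \<longlonglongrightarrow> apply_ucb (u a) x" for x
        using pt s unfolding continuous_on_sequentially o_def by blast
      then show "(\<lambda>n. signed_integral \<mu> (apply_ucb (u (s n)))) \<longlonglongrightarrow> signed_integral \<mu> (apply_ucb (u a))"
        using s bound by (intro signed_integral_tendsto[OF mu]) auto
    qed
  qed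
qed


section \<open>Uniform boundedness on \<open>UC\<^sub>b(E)\<close>\<close>

text \<open>This is the completeness of \<open>UC\<^sub>b(E)\<close> in the form needed below: the series converges
  uniformly, hence to a uniformly continuous function. Only the weaker \<open>\<sigma>\<close>-convergence is
  recorded, as it is what a \<open>\<sigma>\<close>-sequentially continuous operator preserves.\<close>

lemma ucb_series:
  fixes f :: "nat \<Rightarrow> 'a::metric_space ucb"
  assumes f: "\<And>n. norm (f n) \<le> b n" and b: "summable b"
  shows "\<exists>g. limitin sigma_ucb_ca (\<lambda>N. \<Sum>n<N. f n) g sequentially"
proof -
  let ?p = "\<lambda>N x. \<Sum>n<N. apply_ucb (f n) x"
  let ?g = "\<lambda>x. \<Sum>n. apply_ucb (f n) x"
  have fb: "\<bar>apply_ucb (f n) x\<bar> \<le> b n" for n x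
    by (rule order_trans[OF abs_apply_ucb_le_norm f])
  have b0: "b n \<ge> 0" for n using norm_ge_zero[of "f n"] f[of n] by linarith
  have ap: "apply_ucb (\<Sum>n<N. f n) x = ?p N x" for N x
    by (induction N) auto
  have pb: "\<bar>?p N x\<bar> \<le> suminf b" for N x
  proof -
    have "\<bar>?p N x\<bar> \<le> (\<Sum>n<N. b n)" by (rule order_trans[OF sum_abs sum_mono[OF fb]])
    also have "\<dots> \<le> suminf b" using b b0 by (intro sum_le_suminf) auto
    finally show ?thesis .
  qed
  have unif: "uniform_limit UNIV ?p ?g sequentially"
    by (rule Weierstrass_m_test[OF _ b]) (simp add: fb)
  have gb: "\<bar>?g x\<bar> \<le> suminf b" for x
    using norm_suminf_le[OF _ b, of "\<lambda>n. apply_ucb (f n) x"] fb by simp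
  have "uniformly_continuous_on UNIV ?g"
    unfolding uniformly_continuous_on_def
  proof (intro allI impI)
    fix e :: real assume e: "e > 0"
    then obtain N where N: "\<And>x. \<bar>?p N x - ?g x\<bar> < e / 3"
      using uniform_limitD[OF unif, of "e/3"] by (auto simp: eventually_sequentially dist_real_def)
    have "uniformly_continuous_on UNIV (apply_ucb (\<Sum>n<N. f n))" by (rule ucb_uniformly_continuous)
    from uniformly_continuous_onE[OF this, of "e / 3"]
    obtain d where "d > 0"
      and "\<And>x y. dist y x < d \<Longrightarrow>
        dist (apply_ucb (\<Sum>n<N. f n) y) (apply_ucb (\<Sum>n<N. f n) x) < e / 3"
      using e by auto
    then have d: "\<bar>?p N y - ?p N x\<bar> < e / 3" if "dist y x < d" for x y
      using that by (simp add: ap dist_real_def)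
    show "\<exists>d>0. \<forall>x\<in>UNIV. \<forall>y\<in>UNIV. dist y x < d \<longrightarrow> dist (?g y) (?g x) < e"
    proof (intro exI[of _ d] conjI ballI impI \<open>d > 0\<close>)
      fix x y :: 'a assume "dist y x < d"
      then show "dist (?g y) (?g x) < e"
        using N[of x] N[of y] d[of y x] unfolding dist_real_def by linarith
    qed
  qed
  moreover have "bounded (range ?g)"
    using gb by (auto simp: bounded_iff)
  ultimately have "apply_ucb (Ucb ?g) = ?g"
    by (intro Ucb_inverse) simp
  moreover have "(\<lambda>N. ?p N x) \<longlonglongrightarrow> ?g x" for x
    using tendsto_uniform_limitI[OF unif, of x] by simp
  moreover have "norm (\<Sum>n<N. f n) \<le> suminf b" for N
    by (rule norm_ucb_le) (simp add: ap pb)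
  ultimately have "limitin sigma_ucb_ca (\<lambda>N. \<Sum>n<N. f n) (Ucb ?g) sequentially"
    unfolding limitin_sigma_iff by (auto simp: ap bdd_above_def)
  then show ?thesis by blast
qed

text \<open>A Banach-Steinhaus theorem in which \<open>\<sigma>\<close>-sequential continuity replaces norm continuity. It is
  the gliding hump with the unit ball as \<open>D\<close> and the functionals \<open>f \<mapsto> S\<^sub>i f(\<xi>)\<close> as \<open>\<Phi>\<close>: for
  \<open>f\<^sub>n\<close> in the unit ball the series \<open>\<Sum>\<^sub>n 4\<^sup>-\<^sup>n f\<^sub>n\<close> has a sum \<open>g\<close>, and \<open>\<Sum>\<^sub>n 4\<^sup>-\<^sup>n S\<^sub>i f\<^sub>n(\<xi>) = S\<^sub>i g(\<xi>)\<close> is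
  bounded by the norm bound on \<open>{S\<^sub>i g | i \<in> I}\<close>.\<close>

lemma sigma_pointwise_bounded_imp_uniformly_bounded:
  fixes S :: "'i \<Rightarrow> 'a::metric_space ucb \<Rightarrow> 'b::metric_space ucb"
  assumes lin: "\<And>i. i \<in> I \<Longrightarrow> linear (S i)"
    and seq: "\<And>i. i \<in> I \<Longrightarrow> sequentially_continuous_map sigma_ucb_ca sigma_ucb_ca (S i)"
    and bdd: "\<And>f. von_neumann_bounded sigma_ucb_ca ((\<lambda>i. S i f) ` I)"
  shows "\<exists>K. \<forall>i\<in>I. \<forall>f. norm (S i f) \<le> K * norm f"
proof -
  have "\<exists>K. \<forall>\<phi>\<in>{\<lambda>f. apply_ucb (S i f) \<xi> | i \<xi>. i \<in> I}. \<forall>f\<in>{f. norm f \<le> 1}. \<bar>\<phi> f\<bar> \<le> K"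
  proof (rule gliding_hump_bounded)
    fix f :: "nat \<Rightarrow> 'a ucb"
    assume "range f \<subseteq> {f. norm f \<le> 1}"
    then have f: "norm (f n) \<le> 1" for n by auto
    obtain g where g: "limitin sigma_ucb_ca (\<lambda>N. \<Sum>n<N. (1/4)^n *\<^sub>R f n) g sequentially"
      using ucb_series[of "\<lambda>n. (1/4)^n *\<^sub>R f n" "\<lambda>n. (1/4)^n"] f
        summable_geometric[of "1/4::real"] by (auto simp: mult_left_le)
    obtain K where K: "\<And>i. i \<in> I \<Longrightarrow> norm (S i g) \<le> K"
      using bdd[of g] unfolding von_neumann_bounded_sigma_iff by blast
    have "(\<lambda>n. (1/4)^n * apply_ucb (S i (f n)) \<xi>) sums apply_ucb (S i g) \<xi>" if i: "i \<in> I" for i \<xi>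
    proof -
      have "limitin sigma_ucb_ca (\<lambda>N. S i (\<Sum>n<N. (1/4)^n *\<^sub>R f n)) (S i g) sequentially"
        using seq[OF i] g unfolding sequentially_continuous_map_def by blast
      then have "(\<lambda>N. apply_ucb (S i (\<Sum>n<N. (1/4)^n *\<^sub>R f n)) \<xi>) \<longlonglongrightarrow> apply_ucb (S i g) \<xi>"
        unfolding limitin_sigma_iff by blast
      moreover have "apply_ucb (S i (\<Sum>n<N. (1/4)^n *\<^sub>R f n)) \<xi> =
          (\<Sum>n<N. (1/4)^n * apply_ucb (S i (f n)) \<xi>)" for N
        by (induction N)
          (simp_all add: linear_0[OF lin[OF i]] linear_add[OF lin[OF i]] linear_cmul[OF lin[OF i]])
      ultimately show ?thesis by (simp add: sums_def)
    qed
    then show "\<exists>K. \<forall>\<phi>\<in>{\<lambda>f. apply_ucb (S i f) \<xi> | i \<xi>. i \<in> I}.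
        summable (\<lambda>n. (1/4)^n * \<phi> (f n)) \<and> \<bar>\<Sum>n. (1/4)^n * \<phi> (f n)\<bar> \<le> K"
      using order_trans[OF abs_apply_ucb_le_norm K] by (intro exI[of _ K]) (auto simp: sums_iff)
  qed
  then obtain K where bound: "\<forall>\<phi>\<in>{\<lambda>f. apply_ucb (S i f) \<xi> | i \<xi>. i \<in> I}. \<forall>f\<in>{f. norm f \<le> 1}. \<bar>\<phi> f\<bar> \<le> K"
    by (rule exE)
  have K: "\<bar>apply_ucb (S i f) \<xi>\<bar> \<le> K" if "i \<in> I" "norm f \<le> 1" for i f \<xi>
    using bspec[OF bspec[OF bound, of "\<lambda>f. apply_ucb (S i f) \<xi>"], of f] that by auto
  have "norm (S i f) \<le> K * norm f" if i: "i \<in> I" for i f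
  proof (cases "f = 0")
    case True
    then show ?thesis by (simp add: linear_0[OF lin[OF i]])
  next
    case False
    then have "norm (S i (f /\<^sub>R norm f)) \<le> K"
      using K[OF i] by (intro norm_ucb_le) auto
    then have "norm (S i f) / norm f \<le> K"
      by (simp add: linear_cmul[OF lin[OF i]] divide_inverse mult.commute)
    then show ?thesis using False by (simp add: divide_le_eq)
  qed
  then show ?thesis by blast
qed


section \<open>\<open>\<pi>\<close>-semigroups\<close>

text \<open>The rescaling by \<open>e\<^sup>-\<^sup>\<alpha>\<^sup>t\<close> makes each orbit norm bounded on all of \<open>[0, \<infinity>)\<close>, and this bound is what
  gives both the boundedness of the orbit for \<open>\<sigma>\<close> and its continuity.\<close>

lemma bounded_C0_seq_semigroup_if_pi_semigroup:
  fixes T :: "real \<Rightarrow> 'a::metric_space ucb \<Rightarrow> 'a ucb"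
  assumes pi: "pi_semigroup T" and M: "exp_bound T M \<alpha>"
  shows "bounded_C0_seq_semigroup sigma_ucb_ca (\<lambda>t f. exp (- \<alpha> * t) *\<^sub>R T t f)"
proof -
  let ?S = "\<lambda>t f. exp (- \<alpha> * t) *\<^sub>R T t f"
  have bl: "bounded_linear (T t)" if "t \<ge> 0" for t
    using pi that by (simp add: pi_semigroup_def)
  have T0: "T 0 = id"
    using pi by (simp add: pi_semigroup_def)
  have add: "T (t + s) = T t \<circ> T s" if "t \<ge> 0" "s \<ge> 0" for t s
    using pi that by (simp add: pi_semigroup_def)
  have cont: "continuous_on {0..} (\<lambda>t. apply_ucb (T t f) \<xi>)" for f \<xi>
    using pi by (simp add: pi_semigroup_def)
  have conv: "(\<lambda>n. apply_ucb (T t (f n)) x) \<longlonglongrightarrow> apply_ucb (T t g) x"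
    if "t \<ge> 0" "bdd_above (range (\<lambda>n. norm (f n)))"
      "\<forall>x. (\<lambda>n. apply_ucb (f n) x) \<longlonglongrightarrow> apply_ucb g x" for t f g x
    using pi that unfolding pi_semigroup_def by blast
  have bound: "norm (?S t f) \<le> M * norm f" if "t \<ge> 0" for t f
  proof -
    have "norm (?S t f) \<le> exp (- \<alpha> * t) * (M * exp (\<alpha> * t) * norm f)"
      using M that unfolding exp_bound_def norm_scaleR by (intro mult_mono) auto
    also have "\<dots> = M * norm f" by (simp add: exp_minus)
    finally show ?thesis .
  qed
  have linS: "linear (?S t)" if "t \<ge> 0" for t
    using bounded_linear.linear[OF bl[OF that]] by (rule linear_compose_scale_right)
  show ?thesis
    unfolding bounded_C0_seq_semigroup_def
  proof (intro conjI allI impI)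
    show "hausdorff_locally_convex (sigma_ucb_ca :: 'a ucb topology)"
      by (rule hausdorff_locally_convex_sigma_ucb_ca)
    fix t :: real assume t: "t \<ge> 0"
    show "linear (?S t)" by (rule linS[OF t])
    show "sequentially_continuous_map sigma_ucb_ca sigma_ucb_ca (?S t)"
      unfolding sequentially_continuous_map_def
    proof (intro allI impI)
      fix f :: "nat \<Rightarrow> 'a ucb" and g assume "limitin sigma_ucb_ca f g sequentially"
      then have f: "bdd_above (range (\<lambda>n. norm (f n)))"
        "\<forall>x. (\<lambda>n. apply_ucb (f n) x) \<longlonglongrightarrow> apply_ucb g x"
        by (simp_all add: limitin_sigma_iff)
      then obtain C where C: "\<And>n. norm (f n) \<le> C" by (auto simp: bdd_above_def)
      have "norm (?S t (f n)) \<le> \<bar>M\<bar> * C" for n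
      proof -
        have "norm (?S t (f n)) \<le> M * norm (f n)" by (rule bound[OF t])
        also have "\<dots> \<le> \<bar>M\<bar> * norm (f n)" by (simp add: mult_right_mono)
        also have "\<dots> \<le> \<bar>M\<bar> * C" by (simp add: mult_left_mono C)
        finally show ?thesis .
      qed
      then have "bdd_above (range (\<lambda>n. norm (?S t (f n))))" by (meson bdd_above.I2)
      moreover have "(\<lambda>n. apply_ucb (?S t (f n)) x) \<longlonglongrightarrow> apply_ucb (?S t g) x" for x
        using tendsto_mult_left[OF conv[OF t f]] by simp
      ultimately show "limitin sigma_ucb_ca (\<lambda>n. ?S t (f n)) (?S t g) sequentially"
        unfolding limitin_sigma_iff by blast
    qed
    fix s :: real assume s: "s \<ge> 0"
    show "?S (t + s) = ?S t \<circ> ?S s"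
    proof -
      have e: "exp (- \<alpha> * (t + s)) = exp (- \<alpha> * t) * exp (- \<alpha> * s)"
        by (simp add: exp_add[symmetric] algebra_simps)
      show ?thesis
        unfolding add[OF t s] e
        by (simp add: fun_eq_iff linear_cmul[OF bounded_linear.linear[OF bl[OF t]]])
    qed
  next
    show "?S 0 = id" using T0 by (auto simp: fun_eq_iff)
  next
    fix f :: "'a ucb"
    show "continuous_map (top_of_set {0..}) sigma_ucb_ca (\<lambda>t. ?S t f)"
      by (subst continuous_map_sigma_iff[where K = "M * norm f"])
        (use bound cont in \<open>auto intro!: continuous_intros\<close>)
    show "von_neumann_bounded sigma_ucb_ca ((\<lambda>t. ?S t f) ` {0..})"
      unfolding von_neumann_bounded_sigma_iff using bound by (intro exI[of _ "M * norm f"]) auto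
  qed
qed

text \<open>The uniform bound on \<open>S\<^sub>t = e\<^sup>-\<^sup>\<alpha>\<^sup>t T\<^sub>t\<close> comes first: it supplies the exponential bound, the
  boundedness of each operator, and the norm bound on orbits through which pointwise continuity
  in \<open>t\<close> is read off from \<open>\<sigma>\<close>-continuity.\<close>

lemma pi_semigroup_if_bounded_C0_seq_semigroup:
  fixes T :: "real \<Rightarrow> 'a::metric_space ucb \<Rightarrow> 'a ucb"
  assumes lin: "\<And>t. t \<ge> 0 \<Longrightarrow> linear (T t)"
    and C0: "bounded_C0_seq_semigroup sigma_ucb_ca (\<lambda>t f. exp (- \<alpha> * t) *\<^sub>R T t f)"
  shows "pi_semigroup T" "\<exists>M\<ge>1. exp_bound T M \<alpha>"
proof -
  define S where "S t f = exp (- \<alpha> * t) *\<^sub>R T t f" for t f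
  have T: "T t f = exp (\<alpha> * t) *\<^sub>R S t f" for t f
    by (simp add: S_def exp_minus)
  have S: "bounded_C0_seq_semigroup sigma_ucb_ca S"
    using C0 by (simp add: S_def[abs_def])
  have linS: "linear (S t)" and seq: "sequentially_continuous_map sigma_ucb_ca sigma_ucb_ca (S t)"
    if "t \<ge> 0" for t
    using S that by (simp_all add: bounded_C0_seq_semigroup_def)
  have S0: "S 0 = id"
    using S by (simp add: bounded_C0_seq_semigroup_def)
  have add: "S (t + s) = S t \<circ> S s" if "t \<ge> 0" "s \<ge> 0" for t s
    using S that by (simp add: bounded_C0_seq_semigroup_def)
  have cont: "continuous_map (top_of_set {0..}) sigma_ucb_ca (\<lambda>t. S t f)"
    and bdd: "von_neumann_bounded sigma_ucb_ca ((\<lambda>t. S t f) ` {0..})" for f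
    using S by (simp_all add: bounded_C0_seq_semigroup_def)
  have "\<exists>K. \<forall>t\<in>{0..}. \<forall>f. norm (S t f) \<le> K * norm f"
    by (rule sigma_pointwise_bounded_imp_uniformly_bounded) (simp_all add: linS seq bdd)
  then obtain K where K: "\<And>t f. t \<ge> 0 \<Longrightarrow> norm (S t f) \<le> K * norm f"
    by (metis atLeast_iff)
  have TK: "norm (T t f) \<le> max 1 K * exp (\<alpha> * t) * norm f" if "t \<ge> 0" for t f
  proof -
    have "norm (S t f) \<le> max 1 K * norm f"
      using K[OF that, of f] mult_right_mono[of K "max 1 K" "norm f"] by simp
    then show ?thesis by (simp add: T mult.assoc mult.left_commute)
  qed
  then show M: "\<exists>M\<ge>1. exp_bound T M \<alpha>"
    unfolding exp_bound_def by (intro exI[of _ "max 1 K"]) auto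
  show "pi_semigroup T"
    unfolding pi_semigroup_def
  proof (intro conjI allI impI)
    show "bounded_linear (T t)" if "t \<ge> 0" for t
      using lin[OF that] TK[OF that]
      by (intro bounded_linear.intro bounded_linear_axioms.intro exI[of _ "max 1 K * exp (\<alpha> * t)"])
        (auto simp: mult.commute)
    show "T 0 = id" using S0 by (auto simp: fun_eq_iff T)
    show "T t \<circ> T s = T (t + s)" if "t \<ge> 0" "s \<ge> 0" for t s
    proof -
      have e: "exp (\<alpha> * (t + s)) = exp (\<alpha> * t) * exp (\<alpha> * s)"
        by (simp add: exp_add[symmetric] algebra_simps)
      show ?thesis
        by (simp add: fun_eq_iff T add[OF that] e linear_cmul[OF linS[OF that(1)]])
    qed
    show "\<exists>M\<ge>1. \<exists>\<alpha>. exp_bound T M \<alpha>" using M by blast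
    show "continuous_on {0..} (\<lambda>t. apply_ucb (T t f) \<xi>)" for \<xi> f
    proof -
      have "continuous_on {0..} (\<lambda>t. apply_ucb (S t f) \<xi>)"
        using cont[of f] continuous_map_sigma_iff[of "{0..}" "\<lambda>t. S t f" "K * norm f"] K by auto
      then show ?thesis by (auto simp: T intro!: continuous_intros)
    qed
    show "(\<lambda>n. apply_ucb (T t (f n)) x) \<longlonglongrightarrow> apply_ucb (T t g) x"
      if "bdd_above (range (\<lambda>n. norm (f n)))"
        "\<forall>x. (\<lambda>n. apply_ucb (f n) x) \<longlonglongrightarrow> apply_ucb g x" "t \<ge> 0" for f g t x
    proof -
      have "limitin sigma_ucb_ca (\<lambda>n. S t (f n)) (S t g) sequentially"
        using seq[OF that(3)] that(1,2) limitin_sigma_iff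
        unfolding sequentially_continuous_map_def by blast
      then have "(\<lambda>n. apply_ucb (S t (f n)) x) \<longlonglongrightarrow> apply_ucb (S t g) x"
        unfolding limitin_sigma_iff by blast
      then show ?thesis by (simp add: T tendsto_mult_left)
    qed
  qed
qed

theorem proposition4p21:
  fixes T :: "real \<Rightarrow> 'a::metric_space ucb \<Rightarrow> 'a ucb" and \<alpha> :: real
  assumes "\<forall>t\<ge>0. linear (T t)"
  shows "pi_semigroup T \<and> (\<exists>M\<ge>1. exp_bound T M \<alpha>) \<longleftrightarrow>
    bounded_C0_seq_semigroup sigma_ucb_ca (\<lambda>t f. exp (- \<alpha> * t) *\<^sub>R T t f)"
  using assms bounded_C0_seq_semigroup_if_pi_semigroup[of T _ \<alpha>]
    pi_semigroup_if_bounded_C0_seq_semigroup[of T \<alpha>]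
  by blast

end
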